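(* Let $R$ be a complete Noetherian local ring. Let $A\subseteq B$ be Artinian $R$-modules, and let $\mathrm{i}$ be a relative Nakayama interior defined on Artinian $R$-modules. Then the $\mathrm{i}$-hull of $A$ in $B$ is dual to the $\mathrm{cl}$-core of $(B/A)^\vee$ in $B^\vee$, where $\mathrm{cl}$ is the closure operation dual to $\mathrm{i}$; that is, $$\left(\frac{B}{\mathrm{i}\text{-hull}^B(A)}\right)^\vee=\mathrm{cl}\text{-core}_{B^\vee}\left((B/A)^\vee\right)$$ as submodules of $B^\vee$.
   Context: Let $(R,\mathfrak{m},k)$ be a complete Noetherian local ring, $E=E_R(k)$, $(-)^\vee=\mathrm{Hom}_R(-,E)$. For $A\subseteq B$, $(B/A)^\vee$ is regarded as a submodule of $B^\vee$; $B^{\vee\vee}$ is identified with $B$ for $B$ Artinian or finitely generated. A relative interior operation $\mathrm{i}$ on Artinian modules assigns to each pair $A\subseteq B$ of Artinian modules a submodule $A^B_{\mathrm{i}}$, compatibly with isomorphisms of $B$, such that $A^B_{\mathrm{i}}\subseteq A$; $A\subseteq C\subseteq B$ implies $A^B_{\mathrm{i}}\subseteq C^B_{\mathrm{i}}$; and $(A^B_{\mathrm{i}})^B_{\mathrm{i}}=A^B_{\mathrm{i}}$. It is a Nakayama interior if for all Artinian $A\subseteq C\subseteq B$, $(A:_C\mathfrak{m})^B_{\mathrm{i}}\subseteq A$ implies $A^B_{\mathrm{i}}=C^B_{\mathrm{i}}$, where $(A:_C\mathfrak{m})=\{c\in C:\mathfrak{m}c\subseteq A\}$. The dual closure operation on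 pairs $N\subseteq M$ of finitely generated modules is $$N^{\mathrm{cl}}_M=\left(\frac{M^\vee}{\left((M/N)^\vee\right)^{M^\vee}_{\mathrm{i}}}\right)^\vee\subseteq M.$$ The $\mathrm{i}$-hull of $A$ in $B$ is the sum of all $\mathrm{i}$-expansions of $A$ in $B$: $\mathrm{i}\text{-hull}^B(A)=\sum\{C : A\subseteq C\subseteq B,\ C^B_{\mathrm{i}}\subseteq A\}$ (equivalently $A^B_{\mathrm{i}}=C^B_{\mathrm{i}}$). The $\mathrm{cl}$-core of $N$ in $M$ is the intersection of all $\mathrm{cl}$-reductions: $\mathrm{cl}\text{-core}_M(N)=\bigcap\{L : L\subseteq N\subseteq L^{\mathrm{cl}}_M\}$. *)

theory Defs
  imports "HOL-Algebra.Algebra"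
begin

section \<open>Modules, homomorphisms and quotients\<close>

text \<open>
  Submodules are sets, as in the library.  A homomorphism is an extensional function, so that
  \<open>Hom(M, N)\<close> is again a module with equality of functions as its equality.  The fields
  \<open>mult\<close> and \<open>one\<close> of a module record carry no meaning and are left undefined.
\<close>

definition module_hom ::
    "('a, 'r) ring_scheme \<Rightarrow> ('a, 'm) module \<Rightarrow> ('a, 'n) module \<Rightarrow> ('m \<Rightarrow> 'n) set"
  where "module_hom R M N =
    {f \<in> carrier M \<rightarrow>\<^sub>E carrier N.
       (\<forall>x\<in>carrier M. \<forall>y\<in>carrier M. f (x \<oplus>\<^bsub>M\<^esub> y) = f x \<oplus>\<^bsub>N\<^esub> f y) \<and>
       (\<forall>r\<in>carrier R. \<forall>x\<in>carrier M. f (r \<odot>\<^bsub>M\<^esub> x) = r \<odot>\<^bsub>N\<^esub> f x)}"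

definition module_iso ::
    "('a, 'r) ring_scheme \<Rightarrow> ('a, 'm) module \<Rightarrow> ('a, 'n) module \<Rightarrow> ('m \<Rightarrow> 'n) set"
  where "module_iso R M N = {f \<in> module_hom R M N. bij_betw f (carrier M) (carrier N)}"

definition hom_module ::
    "('a, 'r) ring_scheme \<Rightarrow> ('a, 'm) module \<Rightarrow> ('a, 'n) module \<Rightarrow> ('a, 'm \<Rightarrow> 'n) module"
  where "hom_module R M N =
    \<lparr>carrier = module_hom R M N, monoid.mult = undefined, one = undefined,
     ring.zero = (\<lambda>x\<in>carrier M. \<zero>\<^bsub>N\<^esub>),
     add = (\<lambda>f g. \<lambda>x\<in>carrier M. f x \<oplus>\<^bsub>N\<^esub> g x),
     smult = (\<lambda>r f. \<lambda>x\<in>carrier M. r \<odot>\<^bsub>N\<^esub> f x)\<rparr>"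

definition quotient_module :: "('a, 'm) module \<Rightarrow> 'm set \<Rightarrow> ('a, 'm set) module"
  where "quotient_module M N =
    \<lparr>carrier = a_rcosets\<^bsub>M\<^esub> N, monoid.mult = undefined, one = undefined,
     ring.zero = N, add = set_add M,
     smult = (\<lambda>r c. \<Union>x\<in>c. N +>\<^bsub>M\<^esub> (r \<odot>\<^bsub>M\<^esub> x))\<rparr>"

definition regular_module :: "('a, 'r) ring_scheme \<Rightarrow> ('a, 'a) module"
  where "regular_module R =
    \<lparr>carrier = carrier R, monoid.mult = monoid.mult R, one = \<one>\<^bsub>R\<^esub>,
     ring.zero = \<zero>\<^bsub>R\<^esub>, add = add R, smult = monoid.mult R\<rparr>"

definition artinian_module :: "('a, 'r) ring_scheme \<Rightarrow> ('a, 'm) module \<Rightarrow> bool"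
  where "artinian_module R M \<longleftrightarrow> module R M \<and>
    (\<forall>S :: nat \<Rightarrow> 'm set.
       (\<forall>n. submodule (S n) R M) \<and> (\<forall>n. S (Suc n) \<subseteq> S n) \<longrightarrow> (\<exists>n. \<forall>k\<ge>n. S k = S n))"

text \<open>\<open>submodule_colon R I A C M\<close> is \<open>(A :\<^sub>C I)\<close>, for submodules \<open>A \<subseteq> C\<close> of \<open>M\<close>.\<close>

definition submodule_colon ::
    "('a, 'm) module \<Rightarrow> 'a set \<Rightarrow> 'm set \<Rightarrow> 'm set \<Rightarrow> 'm set"
  where "submodule_colon M I A C = {c \<in> C. \<forall>r\<in>I. r \<odot>\<^bsub>M\<^esub> c \<in> A}"

text \<open>The subgroup generated by a family of submodules consists of the finite sums of their
  elements, i.e. it is the sum of the family.\<close>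

definition submodule_sum :: "('a, 'm) module \<Rightarrow> 'm set set \<Rightarrow> 'm set"
  where "submodule_sum M F = generate (add_monoid M) (\<Union>F)"


section \<open>Complete Noetherian local rings\<close>

text \<open>Powers of ideals are taken in the semiring of ideals \<^term>\<open>ideals_set R\<close>.  Completeness
  means that \<open>R \<longrightarrow> lim R/\<mm>\<^sup>n\<close> is bijective, i.e. that \<open>R\<close> is separated and every Cauchy
  sequence converges in the \<open>\<mm>\<close>-adic topology.\<close>

locale complete_noetherian_local_ring = cring R + noetherian_ring R
  for R (structure) and \<mm> +
  assumes maximalideal: "maximalideal \<mm> R"
    and maximalideal_unique: "\<And>J. maximalideal J R \<Longrightarrow> J = \<mm>"
    and separated: "(\<Inter>n::nat. \<mm> [^]\<^bsub>ideals_set R\<^esub> n) = {\<zero>}"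
    and Cauchy_convergent: "\<And>s :: nat \<Rightarrow> 'a. \<lbrakk>range s \<subseteq> carrier R;
        \<And>n::nat. \<exists>K. \<forall>p\<ge>K. \<forall>q\<ge>K. s p \<ominus> s q \<in> \<mm> [^]\<^bsub>ideals_set R\<^esub> n\<rbrakk>
      \<Longrightarrow> \<exists>x\<in>carrier R. \<forall>n::nat. \<exists>K. \<forall>p\<ge>K. s p \<ominus> x \<in> \<mm> [^]\<^bsub>ideals_set R\<^esub> n"

definition residue_module :: "('a, 'r) ring_scheme \<Rightarrow> 'a set \<Rightarrow> ('a, 'a set) module"
  where "residue_module R \<mm> = quotient_module (regular_module R) \<mm>"


section \<open>Injective hulls\<close>

text \<open>The test modules \<open>Y\<close> range over all modules whose carrier lies in the type of the elements
  of \<open>R\<close>, since HOL cannot quantify over types.  This is no restriction: Baer's criterion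
  (\<open>injective_module_extend\<close> below) yields the extension property for modules of every type.\<close>

definition injective_module :: "('a, 'r) ring_scheme \<Rightarrow> ('a, 'e) module \<Rightarrow> bool"
  where "injective_module R E \<longleftrightarrow> module R E \<and>
    (\<forall>(Y :: ('a, 'a) module) S. module R Y \<and> submodule S R Y \<longrightarrow>
       (\<forall>h\<in>module_hom R (Y\<lparr>carrier := S\<rparr>) E. \<exists>g\<in>module_hom R Y E. \<forall>x\<in>S. g x = h x))"

text \<open>\<open>E\<close> is an injective hull of \<open>K\<close>: it is injective and an essential extension of a copy
  of \<open>K\<close>.\<close>

definition injective_hull ::
    "('a, 'r) ring_scheme \<Rightarrow> ('a, 'k) module \<Rightarrow> ('a, 'e) module \<Rightarrow> bool"
  where "injective_hull R K E \<longleftrightarrow> injective_module R E \<and>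
    (\<exists>j\<in>module_hom R K E. inj_on j (carrier K) \<and>
       (\<forall>S. submodule S R E \<and> S \<inter> j ` carrier K = {\<zero>\<^bsub>E\<^esub>} \<longrightarrow> S = {\<zero>\<^bsub>E\<^esub>}))"

lemma module_hom_closed: "f \<in> module_hom R M N \<Longrightarrow> x \<in> carrier M \<Longrightarrow> f x \<in> carrier N"
  by (auto simp: module_hom_def)

lemma module_hom_add:
  "f \<in> module_hom R M N \<Longrightarrow> x \<in> carrier M \<Longrightarrow> y \<in> carrier M \<Longrightarrow>
    f (x \<oplus>\<^bsub>M\<^esub> y) = f x \<oplus>\<^bsub>N\<^esub> f y"
  by (auto simp: module_hom_def)

lemma module_hom_smult:
  "f \<in> module_hom R M N \<Longrightarrow> r \<in> carrier R \<Longrightarrow> x \<in> carrier M \<Longrightarrow>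
    f (r \<odot>\<^bsub>M\<^esub> x) = r \<odot>\<^bsub>N\<^esub> f x"
  by (auto simp: module_hom_def)

lemma module_regular_module:
  assumes "cring R"
  shows "module R (regular_module R)"
proof -
  interpret cring R by fact
  show ?thesis
    unfolding regular_module_def
    by (rule moduleI)
      (use assms in \<open>auto intro!: abelian_groupI simp: a_ac l_distr r_distr m_assoc
         intro: exI[of _ "\<ominus>\<^bsub>R\<^esub> _"] dest: l_neg\<close>)
qed

text \<open>Baer's criterion: Zorn's lemma is applied to the graphs of the homomorphisms that extend
  \<open>h\<close> to larger submodules of \<open>Y\<close>.\<close>

lemma injective_module_extend:
  fixes R :: "('a, 'r) ring_scheme" and E :: "('a, 'e) module" and Y :: "('a, 'y) module"
  assumes inj: "injective_module R E" and Y: "module R Y" and S: "submodule S R Y"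
    and h: "h \<in> module_hom R (Y\<lparr>carrier := S\<rparr>) E"
  shows "\<exists>g\<in>module_hom R Y E. \<forall>x\<in>S. g x = h x"
proof -
  interpret Y: module R Y by fact
  interpret E: module R E using inj by (simp add: injective_module_def)
  have hE: "h x \<in> carrier E" if "x \<in> S" for x
    using module_hom_closed[OF h, of x] that by simp
  have hadd: "h (x \<oplus>\<^bsub>Y\<^esub> y) = h x \<oplus>\<^bsub>E\<^esub> h y" if "x \<in> S" "y \<in> S" for x y
    using module_hom_add[OF h, of x y] that by simp
  have hsmult: "h (r \<odot>\<^bsub>Y\<^esub> x) = r \<odot>\<^bsub>E\<^esub> h x" if "r \<in> carrier R" "x \<in> S" for r x
    using module_hom_smult[OF h, of r x] that by simp
  note XY = Y.submoduleE[OF S]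
  have zX: "\<zero>\<^bsub>Y\<^esub> \<in> S"
    using S subgroup.one_closed[of S "add_monoid Y"] by (simp add: submodule_def)
  have h0: "h \<zero>\<^bsub>Y\<^esub> = \<zero>\<^bsub>E\<^esub>"
    using hsmult[of "\<zero>\<^bsub>R\<^esub>" "\<zero>\<^bsub>Y\<^esub>"] zX hE by simp
  define P where "P = {G. G \<subseteq> carrier Y \<times> carrier E \<and>
     (\<forall>p\<in>G. \<forall>q\<in>G. (fst p \<oplus>\<^bsub>Y\<^esub> fst q, snd p \<oplus>\<^bsub>E\<^esub> snd q) \<in> G) \<and>
     (\<forall>r\<in>carrier R. \<forall>p\<in>G. (r \<odot>\<^bsub>Y\<^esub> fst p, r \<odot>\<^bsub>E\<^esub> snd p) \<in> G) \<and>
     (\<forall>e. (\<zero>\<^bsub>Y\<^esub>, e) \<in> G \<longrightarrow> e = \<zero>\<^bsub>E\<^esub>) \<and> (\<lambda>x. (x, h x)) ` S \<subseteq> G}"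
  have G0: "(\<lambda>x. (x, h x)) ` S \<in> P"
    unfolding P_def using XY hE hadd hsmult h0 by auto
  have chain: "\<Union>C \<in> P" if "C \<noteq> {}" "subset.chain P C" for C
  proof -
    have CP: "C \<subseteq> P" and lin: "\<And>G H. G \<in> C \<Longrightarrow> H \<in> C \<Longrightarrow> G \<subseteq> H \<or> H \<subseteq> G"
      using that(2) by (auto simp: subset_chain_def)
    have mem: "G \<in> P" if "G \<in> C" for G using CP that by blast
    have add: "(fst p \<oplus>\<^bsub>Y\<^esub> fst q, snd p \<oplus>\<^bsub>E\<^esub> snd q) \<in> \<Union>C" if pq: "p \<in> \<Union>C" "q \<in> \<Union>C" for p q
    proof -
      obtain G H where GH: "G \<in> C" "p \<in> G" "H \<in> C" "q \<in> H" using pq by blast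
      then obtain K where K: "K \<in> C" "p \<in> K" "q \<in> K" using lin[of G H] by blast
      then have "(fst p \<oplus>\<^bsub>Y\<^esub> fst q, snd p \<oplus>\<^bsub>E\<^esub> snd q) \<in> K"
        using mem[of K] unfolding P_def by blast
      then show ?thesis using K by blast
    qed
    have sub: "\<Union>C \<subseteq> carrier Y \<times> carrier E"
      using mem unfolding P_def by blast
    have smult: "(r \<odot>\<^bsub>Y\<^esub> fst p, r \<odot>\<^bsub>E\<^esub> snd p) \<in> \<Union>C" if rp: "r \<in> carrier R" "p \<in> \<Union>C" for r p
    proof -
      obtain G where "G \<in> C" "p \<in> G" using rp by blast
      then have "(r \<odot>\<^bsub>Y\<^esub> fst p, r \<odot>\<^bsub>E\<^esub> snd p) \<in> G"
        using mem[of G] rp unfolding P_def by blast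
      then show ?thesis using \<open>G \<in> C\<close> by blast
    qed
    have fn: "e = \<zero>\<^bsub>E\<^esub>" if "(\<zero>\<^bsub>Y\<^esub>, e) \<in> \<Union>C" for e
      using that mem unfolding P_def by blast
    have "(\<lambda>x. (x, h x)) ` S \<subseteq> \<Union>C"
      using \<open>C \<noteq> {}\<close> mem unfolding P_def by blast
    then show ?thesis
      unfolding P_def using sub add smult fn by blast
  qed
  obtain G where GP: "G \<in> P" and max: "\<And>H. H \<in> P \<Longrightarrow> G \<subseteq> H \<Longrightarrow> H = G"
  proof -
    have "P \<noteq> {}" using G0 by (rule ex_in_conv[THEN iffD1, OF exI])
    then have "\<exists>M\<in>P. \<forall>H\<in>P. M \<subseteq> H \<longrightarrow> H = M"
      by (rule subset_Zorn_nonempty) (rule chain)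
    then obtain M where M: "M \<in> P" "\<forall>H\<in>P. M \<subseteq> H \<longrightarrow> H = M" ..
    show ?thesis
      by (rule that[OF M(1)]) (use M(2) in simp)
  qed
  have sub: "\<And>x e. (x, e) \<in> G \<Longrightarrow> x \<in> carrier Y \<and> e \<in> carrier E"
    and add: "\<And>x e y f. (x, e) \<in> G \<Longrightarrow> (y, f) \<in> G \<Longrightarrow> (x \<oplus>\<^bsub>Y\<^esub> y, e \<oplus>\<^bsub>E\<^esub> f) \<in> G"
    and smult: "\<And>r x e. r \<in> carrier R \<Longrightarrow> (x, e) \<in> G \<Longrightarrow> (r \<odot>\<^bsub>Y\<^esub> x, r \<odot>\<^bsub>E\<^esub> e) \<in> G"
    and fn: "\<And>e. (\<zero>\<^bsub>Y\<^esub>, e) \<in> G \<Longrightarrow> e = \<zero>\<^bsub>E\<^esub>"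
    and ext: "\<And>x. x \<in> S \<Longrightarrow> (x, h x) \<in> G"
  proof -
    have GP': "G \<subseteq> carrier Y \<times> carrier E"
      "\<forall>p\<in>G. \<forall>q\<in>G. (fst p \<oplus>\<^bsub>Y\<^esub> fst q, snd p \<oplus>\<^bsub>E\<^esub> snd q) \<in> G"
      "\<forall>r\<in>carrier R. \<forall>p\<in>G. (r \<odot>\<^bsub>Y\<^esub> fst p, r \<odot>\<^bsub>E\<^esub> snd p) \<in> G"
      "\<forall>e. (\<zero>\<^bsub>Y\<^esub>, e) \<in> G \<longrightarrow> e = \<zero>\<^bsub>E\<^esub>" "(\<lambda>x. (x, h x)) ` S \<subseteq> G"
      using GP by (simp_all add: P_def)
    show "\<And>x e. (x, e) \<in> G \<Longrightarrow> x \<in> carrier Y \<and> e \<in> carrier E" using GP'(1) by blast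
    show "(x \<oplus>\<^bsub>Y\<^esub> y, e \<oplus>\<^bsub>E\<^esub> f) \<in> G" if "(x, e) \<in> G" "(y, f) \<in> G" for x e y f
      using bspec[OF bspec[OF GP'(2) that(1)] that(2)] by simp
    show "(r \<odot>\<^bsub>Y\<^esub> x, r \<odot>\<^bsub>E\<^esub> e) \<in> G" if "r \<in> carrier R" "(x, e) \<in> G" for r x e
      using bspec[OF bspec[OF GP'(3) that(1)] that(2)] by simp
    show "\<And>e. (\<zero>\<^bsub>Y\<^esub>, e) \<in> G \<Longrightarrow> e = \<zero>\<^bsub>E\<^esub>" using GP'(4) by blast
    show "\<And>x. x \<in> S \<Longrightarrow> (x, h x) \<in> G" using GP'(5) by blast
  qed
  have minus: "(\<ominus>\<^bsub>Y\<^esub> x, \<ominus>\<^bsub>E\<^esub> e) \<in> G" if "(x, e) \<in> G" for x e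
    using smult[OF Y.R.a_inv_closed[OF Y.R.one_closed] that] sub[OF that]
    by (simp add: Y.smult_l_minus E.smult_l_minus)
  have uniq: "e = f" if "(x, e) \<in> G" "(x, f) \<in> G" for x e f
  proof -
    have "(\<zero>\<^bsub>Y\<^esub>, e \<ominus>\<^bsub>E\<^esub> f) \<in> G"
      using add[OF that(1) minus[OF that(2)]] sub[OF that(1)] by (simp add: Y.M.r_neg E.M.minus_eq)
    then have "e \<ominus>\<^bsub>E\<^esub> f = \<zero>\<^bsub>E\<^esub>" by (rule fn)
    then have "\<ominus>\<^bsub>E\<^esub> (\<ominus>\<^bsub>E\<^esub> f) = e"
      using sub[OF that(1)] sub[OF that(2)] by (subst E.M.minus_equality[of e]) (simp_all add: E.M.minus_eq)
    then show ?thesis using sub[OF that(2)] by simp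
  qed
  have total: "\<exists>e. (y, e) \<in> G" if y: "y \<in> carrier Y" for y
  proof -
    define I where "I = {r \<in> carrier R. \<exists>e. (r \<odot>\<^bsub>Y\<^esub> y, e) \<in> G}"
    define \<phi> where "\<phi> = (\<lambda>r\<in>I. THE e. (r \<odot>\<^bsub>Y\<^esub> y, e) \<in> G)"
    have IR: "r \<in> carrier R" if "r \<in> I" for r using that by (simp add: I_def)
    have \<phi>: "(r \<odot>\<^bsub>Y\<^esub> y, \<phi> r) \<in> G" if r: "r \<in> I" for r
    proof -
      obtain e where e: "(r \<odot>\<^bsub>Y\<^esub> y, e) \<in> G" using r by (auto simp: I_def)
      have "(THE e. (r \<odot>\<^bsub>Y\<^esub> y, e) \<in> G) = e"
        by (rule the_equality, rule e, erule uniq, rule e)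
      then have "\<phi> r = e" using r by (simp add: \<phi>_def)
      then show ?thesis using e by simp
    qed
    have I\<phi>: "r \<in> I \<and> \<phi> r = e" if "r \<in> carrier R" "(r \<odot>\<^bsub>Y\<^esub> y, e) \<in> G" for r e
      using that \<phi>[of r] uniq by (auto simp: I_def)
    have zero: "\<zero>\<^bsub>R\<^esub> \<in> I"
      using I\<phi>[of "\<zero>\<^bsub>R\<^esub>" "h \<zero>\<^bsub>Y\<^esub>"] ext[OF zX] y by simp
    have plus: "r \<oplus>\<^bsub>R\<^esub> s \<in> I \<and> \<phi> (r \<oplus>\<^bsub>R\<^esub> s) = \<phi> r \<oplus>\<^bsub>E\<^esub> \<phi> s" if "r \<in> I" "s \<in> I" for r s
      using I\<phi>[of "r \<oplus>\<^bsub>R\<^esub> s"] add[OF \<phi>[OF that(1)] \<phi>[OF that(2)]] IR[OF that(1)] IR[OF that(2)] y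
      by (simp add: Y.smult_l_distr)
    have times: "r \<otimes>\<^bsub>R\<^esub> s \<in> I \<and> \<phi> (r \<otimes>\<^bsub>R\<^esub> s) = r \<odot>\<^bsub>E\<^esub> \<phi> s" if "r \<in> carrier R" "s \<in> I" for r s
      using I\<phi>[of "r \<otimes>\<^bsub>R\<^esub> s"] smult[OF that(1) \<phi>[OF that(2)]] IR[OF that(2)] that(1) y
      by (simp add: Y.smult_assoc1)
    let ?RR = "regular_module R"
    have mR: "module R ?RR" by (rule module_regular_module[OF Y.R.is_cring])
    have ainv: "\<ominus>\<^bsub>?RR\<^esub> a = \<ominus>\<^bsub>R\<^esub> a" for a
      by (simp add: a_inv_def m_inv_def regular_module_def)
    have IS: "submodule I R ?RR"
    proof (rule module.submoduleI[OF mR])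
      show "I \<subseteq> carrier ?RR" using IR by (auto simp: regular_module_def)
      show "\<zero>\<^bsub>?RR\<^esub> \<in> I" using zero by (simp add: regular_module_def)
      show "\<ominus>\<^bsub>?RR\<^esub> a \<in> I" if "a \<in> I" for a
        using times[of "\<ominus>\<^bsub>R\<^esub> \<one>\<^bsub>R\<^esub>" a] that IR[OF that] by (simp add: ainv Y.R.l_minus)
      show "a \<oplus>\<^bsub>?RR\<^esub> b \<in> I" if "a \<in> I" "b \<in> I" for a b
        using plus[OF that] by (simp add: regular_module_def)
      show "a \<odot>\<^bsub>?RR\<^esub> b \<in> I" if "a \<in> carrier R" "b \<in> I" for a b
        using times[OF that] by (simp add: regular_module_def)
    qed
    have "\<phi> \<in> extensional I" by (simp add: \<phi>_def)
    moreover have "\<phi> r \<in> carrier E" if "r \<in> I" for r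
      using sub \<phi>[OF that] by blast
    ultimately have "\<phi> \<in> module_hom R (?RR\<lparr>carrier := I\<rparr>) E"
      using plus times by (simp add: module_hom_def regular_module_def PiE_def Pi_def)
    then obtain g where g: "g \<in> module_hom R ?RR E" and g\<phi>: "\<And>r. r \<in> I \<Longrightarrow> g r = \<phi> r"
      using inj mR IS unfolding injective_module_def by blast
    define u where "u = g \<one>\<^bsub>R\<^esub>"
    have u: "u \<in> carrier E"
      using module_hom_closed[OF g, of "\<one>\<^bsub>R\<^esub>"] by (simp add: u_def regular_module_def)
    have gu: "g r = r \<odot>\<^bsub>E\<^esub> u" if "r \<in> carrier R" for r
      using module_hom_smult[OF g that, of "\<one>\<^bsub>R\<^esub>"] that by (simp add: u_def regular_module_def)
    define H where "H = {(x \<oplus>\<^bsub>Y\<^esub> r \<odot>\<^bsub>Y\<^esub> y, e \<oplus>\<^bsub>E\<^esub> r \<odot>\<^bsub>E\<^esub> u) | x e r. (x, e) \<in> G \<and> r \<in> carrier R}"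
    have GH: "G \<subseteq> H"
    proof
      fix p assume "p \<in> G"
      then have "(fst p, snd p) \<in> G" by simp
      then show "p \<in> H"
        using sub[of "fst p" "snd p"] y u unfolding H_def mem_Collect_eq
        by (intro exI[of _ "fst p"] exI[of _ "snd p"] exI[of _ "\<zero>\<^bsub>R\<^esub>"]) simp
    qed
    have "H \<in> P"
    proof -
      have 1: "H \<subseteq> carrier Y \<times> carrier E"
        using sub y u by (auto simp: H_def)
      have 2: "(fst p \<oplus>\<^bsub>Y\<^esub> fst q, snd p \<oplus>\<^bsub>E\<^esub> snd q) \<in> H" if p: "p \<in> H" and q: "q \<in> H" for p q
      proof -
        obtain x e r where p': "p = (x \<oplus>\<^bsub>Y\<^esub> r \<odot>\<^bsub>Y\<^esub> y, e \<oplus>\<^bsub>E\<^esub> r \<odot>\<^bsub>E\<^esub> u)" "(x, e) \<in> G" "r \<in> carrier R"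
          using p unfolding H_def by blast
        obtain x' e' r' where q': "q = (x' \<oplus>\<^bsub>Y\<^esub> r' \<odot>\<^bsub>Y\<^esub> y, e' \<oplus>\<^bsub>E\<^esub> r' \<odot>\<^bsub>E\<^esub> u)" "(x', e') \<in> G" "r' \<in> carrier R"
          using q unfolding H_def by blast
        have "fst p \<oplus>\<^bsub>Y\<^esub> fst q = (x \<oplus>\<^bsub>Y\<^esub> x') \<oplus>\<^bsub>Y\<^esub> (r \<oplus>\<^bsub>R\<^esub> r') \<odot>\<^bsub>Y\<^esub> y"
          "snd p \<oplus>\<^bsub>E\<^esub> snd q = (e \<oplus>\<^bsub>E\<^esub> e') \<oplus>\<^bsub>E\<^esub> (r \<oplus>\<^bsub>R\<^esub> r') \<odot>\<^bsub>E\<^esub> u"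
          using p' q' sub[OF p'(2)] sub[OF q'(2)] y u
          by (simp_all add: Y.smult_l_distr E.smult_l_distr Y.M.a_ac E.M.a_ac)
        then show ?thesis
          using add[OF p'(2) q'(2)] p'(3) q'(3) unfolding H_def by blast
      qed
      have 3: "(s \<odot>\<^bsub>Y\<^esub> fst p, s \<odot>\<^bsub>E\<^esub> snd p) \<in> H" if s: "s \<in> carrier R" and p: "p \<in> H" for s p
      proof -
        obtain x e r where p': "p = (x \<oplus>\<^bsub>Y\<^esub> r \<odot>\<^bsub>Y\<^esub> y, e \<oplus>\<^bsub>E\<^esub> r \<odot>\<^bsub>E\<^esub> u)" "(x, e) \<in> G" "r \<in> carrier R"
          using p unfolding H_def by blast
        have "s \<odot>\<^bsub>Y\<^esub> fst p = s \<odot>\<^bsub>Y\<^esub> x \<oplus>\<^bsub>Y\<^esub> (s \<otimes>\<^bsub>R\<^esub> r) \<odot>\<^bsub>Y\<^esub> y"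
          "s \<odot>\<^bsub>E\<^esub> snd p = s \<odot>\<^bsub>E\<^esub> e \<oplus>\<^bsub>E\<^esub> (s \<otimes>\<^bsub>R\<^esub> r) \<odot>\<^bsub>E\<^esub> u"
          using p' s sub[OF p'(2)] y u
          by (simp_all add: Y.smult_r_distr E.smult_r_distr Y.smult_assoc1 E.smult_assoc1)
        then show ?thesis
          using smult[OF s p'(2)] p'(3) s unfolding H_def by blast
      qed
      have 4: "e = \<zero>\<^bsub>E\<^esub>" if H: "(\<zero>\<^bsub>Y\<^esub>, e) \<in> H" for e
      proof -
        obtain x f r where *: "\<zero>\<^bsub>Y\<^esub> = x \<oplus>\<^bsub>Y\<^esub> r \<odot>\<^bsub>Y\<^esub> y" "e = f \<oplus>\<^bsub>E\<^esub> r \<odot>\<^bsub>E\<^esub> u" "(x, f) \<in> G" "r \<in> carrier R"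
          using H unfolding H_def by blast
        have ry: "r \<odot>\<^bsub>Y\<^esub> y = \<ominus>\<^bsub>Y\<^esub> x"
          using *(1,4) sub[OF *(3)] y Y.M.minus_equality[of "r \<odot>\<^bsub>Y\<^esub> y" x] by (simp add: Y.M.a_comm)
        then have "r \<in> I \<and> \<phi> r = \<ominus>\<^bsub>E\<^esub> f"
          using I\<phi>[OF *(4), of "\<ominus>\<^bsub>E\<^esub> f"] minus[OF *(3)] by simp
        then have "r \<odot>\<^bsub>E\<^esub> u = \<ominus>\<^bsub>E\<^esub> f" using g\<phi>[of r] gu[OF *(4)] by simp
        then show ?thesis using *(2) sub[OF *(3)] by (simp add: E.M.r_neg)
      qed
      have 5: "(\<lambda>x. (x, h x)) ` S \<subseteq> H" using ext GH by auto
      show ?thesis unfolding P_def using 1 2 3 4 5 by blast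
    qed
    then have "H = G" using max GH by blast
    moreover have "(\<zero>\<^bsub>Y\<^esub> \<oplus>\<^bsub>Y\<^esub> \<one>\<^bsub>R\<^esub> \<odot>\<^bsub>Y\<^esub> y, h \<zero>\<^bsub>Y\<^esub> \<oplus>\<^bsub>E\<^esub> \<one>\<^bsub>R\<^esub> \<odot>\<^bsub>E\<^esub> u) \<in> H"
      using ext[OF zX] unfolding H_def by blast
    ultimately show ?thesis using y by auto
  qed
  define g where "g = (\<lambda>y\<in>carrier Y. THE e. (y, e) \<in> G)"
  have gG: "(y, g y) \<in> G" if y: "y \<in> carrier Y" for y
  proof -
    obtain e where e: "(y, e) \<in> G" using total[OF y] by blast
    have "(THE e. (y, e) \<in> G) = e"
      by (rule the_equality, rule e, erule uniq, rule e)
    then have "g y = e" using y by (simp add: g_def)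
    then show ?thesis using e by simp
  qed
  have geq: "g y = e" if "(y, e) \<in> G" for y e
    using that gG[of y] sub[OF that] uniq by blast
  have "g \<in> extensional (carrier Y)" by (simp add: g_def)
  moreover have "g y \<in> carrier E" if "y \<in> carrier Y" for y
    using sub[OF gG[OF that]] by blast
  moreover have "g (x \<oplus>\<^bsub>Y\<^esub> y) = g x \<oplus>\<^bsub>E\<^esub> g y" if "x \<in> carrier Y" "y \<in> carrier Y" for x y
    by (rule geq[OF add[OF gG[OF that(1)] gG[OF that(2)]]])
  moreover have "g (r \<odot>\<^bsub>Y\<^esub> x) = r \<odot>\<^bsub>E\<^esub> g x" if "r \<in> carrier R" "x \<in> carrier Y" for r x
    by (rule geq[OF smult[OF that(1) gG[OF that(2)]]])
  ultimately have "g \<in> module_hom R Y E" by (simp add: module_hom_def PiE_def Pi_def)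
  moreover have "\<forall>x\<in>S. g x = h x" using ext geq by blast
  ultimately show ?thesis by blast
qed


section \<open>Matlis duality\<close>

abbreviation matlis_dual ::
    "('a, 'r) ring_scheme \<Rightarrow> ('a, 'e) module \<Rightarrow> ('a, 'm) module \<Rightarrow> ('a, 'm \<Rightarrow> 'e) module"
  where "matlis_dual R E M \<equiv> hom_module R M E"

text \<open>\<open>(M/N)\<^sup>\<or>\<close> as a submodule of \<open>M\<^sup>\<or>\<close>, embedded by the dual of the projection \<open>M \<longrightarrow> M/N\<close>.\<close>

definition dual_quotient ::
    "('a, 'r) ring_scheme \<Rightarrow> ('a, 'e) module \<Rightarrow> ('a, 'm) module \<Rightarrow> 'm set \<Rightarrow> ('m \<Rightarrow> 'e) set"
  where "dual_quotient R E M N =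
    (\<lambda>g. \<lambda>x\<in>carrier M. g (N +>\<^bsub>M\<^esub> x)) ` carrier (matlis_dual R E (quotient_module M N))"

text \<open>The biduality map \<open>M \<longrightarrow> M\<^sup>\<or>\<^sup>\<or>\<close>, by which \<open>M\<close> and \<open>M\<^sup>\<or>\<^sup>\<or>\<close> are identified.\<close>

definition biduality ::
    "('a, 'r) ring_scheme \<Rightarrow> ('a, 'e) module \<Rightarrow> ('a, 'm) module \<Rightarrow> 'm \<Rightarrow> ('m \<Rightarrow> 'e) \<Rightarrow> 'e"
  where "biduality R E M = (\<lambda>x\<in>carrier M. \<lambda>f\<in>carrier (matlis_dual R E M). f x)"


section \<open>Relative interiors and dual closures\<close>

text \<open>
  \<open>i A B\<close> is \<open>A\<^sup>B\<^sub>i\<close>.  The type \<open>'u\<close> is a universe: the operation is given on the Artinian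
  modules whose carrier lies in \<open>'u\<close>.  By invariance under isomorphisms it has exactly one
  extension to the modules, of any type, that are isomorphic to one of these; this extension is
  \<open>interior_ext\<close>.  If \<open>'u\<close> is infinite and at least as large as \<open>R\<close>, these are all Artinian
  modules.
\<close>

definition relative_interior ::
    "('a, 'r) ring_scheme \<Rightarrow> ('u set \<Rightarrow> ('a, 'u) module \<Rightarrow> 'u set) \<Rightarrow> bool"
  where "relative_interior R i \<longleftrightarrow>
    (\<forall>B A. artinian_module R B \<and> submodule A R B \<longrightarrow>
       submodule (i A B) R B \<and> i A B \<subseteq> A \<and> i (i A B) B = i A B) \<and>
    (\<forall>B A C. artinian_module R B \<and> submodule A R B \<and> submodule C R B \<and> A \<subseteq> C \<longrightarrow>
       i A B \<subseteq> i C B) \<and>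
    (\<forall>B A B'. artinian_module R B \<and> submodule A R B \<and> artinian_module R B' \<longrightarrow>
       (\<forall>\<phi>\<in>module_iso R B B'. \<phi> ` i A B = i (\<phi> ` A) B'))"

definition nakayama_interior ::
    "('a, 'r) ring_scheme \<Rightarrow> 'a set \<Rightarrow> ('u set \<Rightarrow> ('a, 'u) module \<Rightarrow> 'u set) \<Rightarrow> bool"
  where "nakayama_interior R \<mm> i \<longleftrightarrow> relative_interior R i \<and>
    (\<forall>B A C. artinian_module R B \<and> submodule A R B \<and> submodule C R B \<and> A \<subseteq> C \<and>
       i (submodule_colon B \<mm> A C) B \<subseteq> A \<longrightarrow> i A B = i C B)"

definition interior_ext ::
    "('a, 'r) ring_scheme \<Rightarrow> ('u set \<Rightarrow> ('a, 'u) module \<Rightarrow> 'u set) \<Rightarrow>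
       'y set \<Rightarrow> ('a, 'y) module \<Rightarrow> 'y set"
  where "interior_ext R i A B =
    {b \<in> carrier B. \<exists>(B' :: ('a, 'u) module) \<phi>.
       artinian_module R B' \<and> \<phi> \<in> module_iso R B B' \<and> \<phi> b \<in> i (\<phi> ` A) B'}"

text \<open>The dual closure \<open>N\<^sup>c\<^sup>l\<^sub>M = (M\<^sup>\<or> / ((M/N)\<^sup>\<or>)\<^sub>i)\<^sup>\<or>\<close>, where the interior is taken in \<open>M\<^sup>\<or>\<close>.
  The right-hand side is a submodule of \<open>M\<^sup>\<or>\<^sup>\<or>\<close> and is pulled back to \<open>M\<close>.
  Only finitely generated \<open>M\<close> are of interest: their duals are Artinian.\<close>

definition dual_closure ::
    "('a, 'r) ring_scheme \<Rightarrow> ('a, 'e) module \<Rightarrow> ('u set \<Rightarrow> ('a, 'u) module \<Rightarrow> 'u set) \<Rightarrow>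
       'm set \<Rightarrow> ('a, 'm) module \<Rightarrow> 'm set"
  where "dual_closure R E i N M =
    {x \<in> carrier M. biduality R E M x \<in>
       dual_quotient R E (matlis_dual R E M)
         (interior_ext R i (dual_quotient R E M N) (matlis_dual R E M))}"

definition interior_hull ::
    "('a, 'r) ring_scheme \<Rightarrow> ('u set \<Rightarrow> ('a, 'u) module \<Rightarrow> 'u set) \<Rightarrow>
       'u set \<Rightarrow> ('a, 'u) module \<Rightarrow> 'u set"
  where "interior_hull R i A B =
    submodule_sum B {C. submodule C R B \<and> A \<subseteq> C \<and> i C B \<subseteq> A}"

definition closure_core ::
    "('a, 'r) ring_scheme \<Rightarrow> ('m set \<Rightarrow> ('a, 'm) module \<Rightarrow> 'm set) \<Rightarrow>
       'm set \<Rightarrow> ('a, 'm) module \<Rightarrow> 'm set"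
  where "closure_core R cl N M = \<Inter>{L. submodule L R M \<and> L \<subseteq> N \<and> N \<subseteq> cl L M}"

lemma module_isoE:
  assumes "\<phi> \<in> module_iso R M N"
  shows "\<phi> \<in> module_hom R M N" "inj_on \<phi> (carrier M)" "\<phi> ` carrier M = carrier N"
  using assms by (simp_all add: module_iso_def bij_betw_def)

lemma submodule_image:
  assumes M: "module R M" and N: "module R N" and f: "f \<in> module_hom R M N" and A: "submodule A R M"
  shows "submodule (f ` A) R N"
proof -
  interpret M: module R M by fact
  interpret N: module R N by fact
  note A' = M.submoduleE[OF A]
  have zA: "\<zero>\<^bsub>M\<^esub> \<in> A"
    using A subgroup.one_closed[of A "add_monoid M"] by (simp add: submodule_def)
  have f0: "f \<zero>\<^bsub>M\<^esub> = \<zero>\<^bsub>N\<^esub>"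
    using module_hom_smult[OF f, of "\<zero>\<^bsub>R\<^esub>" "\<zero>\<^bsub>M\<^esub>"] module_hom_closed[OF f, of "\<zero>\<^bsub>M\<^esub>"] by simp
  have clo: "f x \<in> carrier N" if "x \<in> A" for x
    by (rule module_hom_closed[OF f subsetD[OF A'(1) that]])
  have sm: "r \<odot>\<^bsub>N\<^esub> f x \<in> f ` A" if "r \<in> carrier R" "x \<in> A" for r x
    using module_hom_smult[OF f that(1) subsetD[OF A'(1) that(2)], symmetric] imageI[OF A'(4)[OF that], of f]
    by simp
  show ?thesis
  proof (rule N.submoduleI)
    show "f ` A \<subseteq> carrier N" using clo by blast
    show "\<zero>\<^bsub>N\<^esub> \<in> f ` A" using imageI[OF zA, of f] by (simp add: f0)
    show "\<ominus>\<^bsub>N\<^esub> a \<in> f ` A" if a: "a \<in> f ` A" for a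
    proof -
      obtain x where x: "x \<in> A" "a = f x" using a by blast
      then show ?thesis
        using sm[of "\<ominus>\<^bsub>R\<^esub> \<one>\<^bsub>R\<^esub>" x] clo[of x] by (simp add: N.smult_l_minus)
    qed
    show "a \<oplus>\<^bsub>N\<^esub> b \<in> f ` A" if ab: "a \<in> f ` A" "b \<in> f ` A" for a b
    proof -
      obtain x y where x: "x \<in> A" "a = f x" "y \<in> A" "b = f y" using ab by blast
      then have "a \<oplus>\<^bsub>N\<^esub> b = f (x \<oplus>\<^bsub>M\<^esub> y)"
        using module_hom_add[OF f, of x y] A'(1) by (simp add: subset_iff)
      then show ?thesis using imageI[OF A'(5)[OF x(1,3)], of f] by simp
    qed
    show "a \<odot>\<^bsub>N\<^esub> x \<in> f ` A" if "a \<in> carrier R" "x \<in> f ` A" for a x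
      using that sm by blast
  qed
qed

lemma module_iso_transition:
  assumes B: "module R B" and f: "f \<in> module_iso R B M" and g: "g \<in> module_iso R B N"
  defines "h \<equiv> \<lambda>y\<in>carrier M. g (inv_into (carrier B) f y)"
  shows "h \<in> module_iso R M N" and "\<And>b. b \<in> carrier B \<Longrightarrow> h (f b) = g b"
proof -
  interpret B: module R B by fact
  note f' = module_isoE[OF f] and g' = module_isoE[OF g]
  show hf: "h (f b) = g b" if "b \<in> carrier B" for b
    using module_hom_closed[OF f'(1) that] inv_into_f_f[OF f'(2) that] by (simp add: h_def)
  have e: "h \<in> extensional (carrier M)" by (simp add: h_def)
  have "h y \<in> carrier N" if y: "y \<in> carrier M" for y
  proof -
    obtain b where "b \<in> carrier B" "y = f b" using y unfolding f'(3)[symmetric] by (elim imageE)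
    then show ?thesis using hf module_hom_closed[OF g'(1)] by simp
  qed
  moreover have "h (x \<oplus>\<^bsub>M\<^esub> y) = h x \<oplus>\<^bsub>N\<^esub> h y" if xy: "x \<in> carrier M" "y \<in> carrier M" for x y
  proof -
    obtain a b where ab: "a \<in> carrier B" "b \<in> carrier B" "x = f a" "y = f b"
      using xy unfolding f'(3)[symmetric] by (elim imageE)
    then have "x \<oplus>\<^bsub>M\<^esub> y = f (a \<oplus>\<^bsub>B\<^esub> b)" using module_hom_add[OF f'(1)] by simp
    then show ?thesis using ab hf module_hom_add[OF g'(1)] by simp
  qed
  moreover have "h (r \<odot>\<^bsub>M\<^esub> x) = r \<odot>\<^bsub>N\<^esub> h x" if rx: "r \<in> carrier R" "x \<in> carrier M" for r x
  proof -
    obtain a where a: "a \<in> carrier B" "x = f a" using rx(2) unfolding f'(3)[symmetric] by (elim imageE)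
    then have "r \<odot>\<^bsub>M\<^esub> x = f (r \<odot>\<^bsub>B\<^esub> a)" using module_hom_smult[OF f'(1)] rx by simp
    then show ?thesis using a rx hf module_hom_smult[OF g'(1)] by simp
  qed
  ultimately have "h \<in> module_hom R M N" using e by (simp add: module_hom_def PiE_def Pi_def)
  moreover have "inj_on h (carrier M)"
  proof (rule inj_onI)
    fix x y assume xy: "x \<in> carrier M" "y \<in> carrier M" "h x = h y"
    obtain a b where ab: "a \<in> carrier B" "b \<in> carrier B" "x = f a" "y = f b"
      using xy(1,2) unfolding f'(3)[symmetric] by (elim imageE)
    then show "x = y" using xy(3) hf inj_onD[OF g'(2), of a b] by simp
  qed
  moreover have "h ` carrier M = carrier N"
  proof -
    have "h ` carrier M = h ` f ` carrier B" by (simp add: f'(3))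
    also have "\<dots> = g ` carrier B" unfolding image_image using hf by (rule image_cong[OF refl])
    finally show ?thesis by (simp add: g'(3))
  qed
  ultimately show "h \<in> module_iso R M N" by (simp add: module_iso_def bij_betw_def)
qed

text \<open>The extension does not depend on the chosen copy of \<open>B\<close> in the universe.\<close>

lemma interior_ext_image:
  fixes R :: "('a, 'r) ring_scheme" and i :: "'u set \<Rightarrow> ('a, 'u) module \<Rightarrow> 'u set"
    and B :: "('a, 'y) module" and B' :: "('a, 'u) module"
  assumes i: "relative_interior R i" and B: "module R B" and B': "artinian_module R B'"
    and \<phi>: "\<phi> \<in> module_iso R B B'" and A: "submodule A R B"
  shows "\<phi> ` interior_ext R i A B = i (\<phi> ` A) B'"
proof -
  note \<phi>' = module_isoE[OF \<phi>]
  have AB: "A \<subseteq> carrier B" using module.submoduleE(1)[OF B A] .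
  have sub: "submodule (f ` A) R N"
    if "artinian_module R N" "f \<in> module_iso R B N" for N :: "('a, 'u) module" and f
    using submodule_image[OF B _ module_isoE(1)[OF that(2)] A] that(1)
    by (simp add: artinian_module_def)
  have "i (\<phi> ` A) B' \<subseteq> \<phi> ` A"
    using i sub[OF B' \<phi>] B' by (simp add: relative_interior_def)
  then have isub: "i (\<phi> ` A) B' \<subseteq> \<phi> ` carrier B" using AB by blast
  have "b \<in> interior_ext R i A B \<longleftrightarrow> \<phi> b \<in> i (\<phi> ` A) B'" if b: "b \<in> carrier B" for b
  proof
    show "b \<in> interior_ext R i A B" if "\<phi> b \<in> i (\<phi> ` A) B'"
      unfolding interior_ext_def mem_Collect_eq using that b B' \<phi> by (intro conjI exI)
  next
    assume "b \<in> interior_ext R i A B"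
    then obtain N :: "('a, 'u) module" and f
      where N: "artinian_module R N" and f: "f \<in> module_iso R B N" and fb: "f b \<in> i (f ` A) N"
      unfolding interior_ext_def mem_Collect_eq by (elim conjE exE)
    obtain h where h: "h \<in> module_iso R N B'" and hf: "\<And>b. b \<in> carrier B \<Longrightarrow> h (f b) = \<phi> b"
      by (rule that[OF module_iso_transition[OF B f \<phi>]])
    have "h ` i (f ` A) N = i (h ` f ` A) B'"
      using i N sub[OF N f] B' h by (simp add: relative_interior_def)
    moreover have "h ` f ` A = \<phi> ` A"
      using hf AB by (auto simp: image_image subset_iff)
    ultimately show "\<phi> b \<in> i (\<phi> ` A) B'" using fb hf[OF b] by (metis imageI)
  qed
  moreover have "interior_ext R i A B \<subseteq> carrier B" by (auto simp: interior_ext_def)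
  ultimately have "interior_ext R i A B = {b \<in> carrier B. \<phi> b \<in> i (\<phi> ` A) B'}" by blast
  then show ?thesis using isub by blast
qed

end

theory Submission
  imports Defs
begin

text \<open>
  Sending a submodule \<open>C\<close> of \<open>B\<close> to its annihilator, the functionals in \<open>B\<^sup>\<or>\<close> that vanish on \<open>C\<close>,
  realizes \<open>(B/C)\<^sup>\<or>\<close> inside \<open>B\<^sup>\<or>\<close> and reverses inclusions.  For Artinian \<open>B\<close> it is a bijection onto
  the submodules of \<open>B\<^sup>\<or>\<close>, with the common kernel as inverse (\<open>common_kernel_annihilator\<close> and
  \<open>annihilator_common_kernel\<close>).  Under this bijection the dual closure of \<open>L\<close> is the annihilator of
  the interior of the common kernel of \<open>L\<close> (\<open>dual_closure_eq_annihilator\<close>).  For \<open>L\<close> the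
  annihilator of \<open>C\<close>, the condition \<open>L \<subseteq> (B/A)\<^sup>\<or>\<close> therefore says \<open>A \<subseteq> C\<close>, and \<open>(B/A)\<^sup>\<or> \<subseteq> L\<^sup>c\<^sup>l\<close> says
  that the interior of \<open>C\<close> lies in \<open>A\<close>: the reductions of \<open>(B/A)\<^sup>\<or>\<close> are exactly the annihilators of
  the expansions of \<open>A\<close>.  The annihilator of a sum is the intersection of the annihilators, which
  is the claim.

  The substance is the part of Matlis duality behind this.  One inverse law holds because \<open>E\<close>
  cogenerates (\<open>cogenerator\<close>).  The other one, and the surjectivity of \<open>B \<longrightarrow> B\<^sup>\<or>\<^sup>\<or>\<close>, rest on
  \<open>End(E) = R\<close> (\<open>endomorphism_is_multiplication\<close>), where the completeness of \<open>R\<close> enters: an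
  endomorphism is a multiplication on each submodule of elements killed by \<open>\<mm>\<^sup>n\<close>, and the
  multipliers converge.  From this, a functional that vanishes on the common kernel of finitely
  many others lies in their span (\<open>finite_double_annihilator\<close>), and an element of \<open>B\<^sup>\<or>\<^sup>\<or>\<close> agrees on
  finitely many functionals with the evaluation at a point (\<open>finite_evaluation\<close>).  The descending
  chain condition passes from finitely many functionals to all of them.
\<close>


section \<open>Homomorphisms and dual modules\<close>

lemma (in module) submodule_zero: "submodule S R M \<Longrightarrow> \<zero>\<^bsub>M\<^esub> \<in> S"
  using subgroup.one_closed[of S "add_monoid M"] by (simp add: submodule_def)

lemma (in module) submodule_diff: "submodule S R M \<Longrightarrow> x \<in> S \<Longrightarrow> y \<in> S \<Longrightarrow> x \<ominus>\<^bsub>M\<^esub> y \<in> S"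
  using submoduleE(3,5)[of S] by (simp add: a_minus_def)

lemma (in module) zero_submodule: "submodule {\<zero>\<^bsub>M\<^esub>} R M"
  by (rule submoduleI) auto

lemma (in module) smult_diff_left:
  "a \<in> carrier R \<Longrightarrow> b \<in> carrier R \<Longrightarrow> x \<in> carrier M \<Longrightarrow>
    (a \<ominus>\<^bsub>R\<^esub> b) \<odot>\<^bsub>M\<^esub> x = a \<odot>\<^bsub>M\<^esub> x \<ominus>\<^bsub>M\<^esub> b \<odot>\<^bsub>M\<^esub> x"
  by (simp add: a_minus_def smult_l_distr smult_l_minus)

lemma (in module) smult_diff_right:
  "a \<in> carrier R \<Longrightarrow> x \<in> carrier M \<Longrightarrow> y \<in> carrier M \<Longrightarrow>
    a \<odot>\<^bsub>M\<^esub> (x \<ominus>\<^bsub>M\<^esub> y) = a \<odot>\<^bsub>M\<^esub> x \<ominus>\<^bsub>M\<^esub> a \<odot>\<^bsub>M\<^esub> y"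
  by (simp add: a_minus_def smult_r_distr smult_r_minus)

lemma (in abelian_group) diff_eq_zero_iff:
  "x \<in> carrier G \<Longrightarrow> y \<in> carrier G \<Longrightarrow> x \<ominus> y = \<zero> \<longleftrightarrow> x = y"
  by (metis a_minus_def add.inv_closed minus_equality minus_minus r_neg)

lemma (in abelian_group) diff_add_cancel:
  "x \<in> carrier G \<Longrightarrow> y \<in> carrier G \<Longrightarrow> (x \<ominus> y) \<oplus> y = x"
  by (simp add: a_minus_def a_assoc l_neg)

lemma (in module) smult_comm:
  "a \<in> carrier R \<Longrightarrow> b \<in> carrier R \<Longrightarrow> x \<in> carrier M \<Longrightarrow>
    a \<odot>\<^bsub>M\<^esub> (b \<odot>\<^bsub>M\<^esub> x) = b \<odot>\<^bsub>M\<^esub> (a \<odot>\<^bsub>M\<^esub> x)"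
  by (metis smult_assoc1 R.m_comm)

lemma (in module) colon_element_ideal:
  assumes S: "submodule S R M" and x: "x \<in> carrier M"
  shows "ideal {r \<in> carrier R. r \<odot>\<^bsub>M\<^esub> x \<in> S} R"
proof -
  note S' = submoduleE[OF S]
  show ?thesis
  proof (rule idealI)
    show "ring R" by (rule R.ring_axioms)
    show "subgroup {r \<in> carrier R. r \<odot>\<^bsub>M\<^esub> x \<in> S} (add_monoid R)"
    proof (rule R.add.subgroupI)
      show "\<ominus>\<^bsub>R\<^esub> a \<in> {r \<in> carrier R. r \<odot>\<^bsub>M\<^esub> x \<in> S}"
        if "a \<in> {r \<in> carrier R. r \<odot>\<^bsub>M\<^esub> x \<in> S}" for a
        using that S'(3) x by (simp add: smult_l_minus)
      have "\<zero>\<^bsub>R\<^esub> \<in> {r \<in> carrier R. r \<odot>\<^bsub>M\<^esub> x \<in> S}" using x submodule_zero[OF S] by simp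
      then show "{r \<in> carrier R. r \<odot>\<^bsub>M\<^esub> x \<in> S} \<noteq> {}" by blast
    qed (use S' x in \<open>auto simp: smult_l_distr\<close>)
    fix a r assume a: "a \<in> {r \<in> carrier R. r \<odot>\<^bsub>M\<^esub> x \<in> S}" and r: "r \<in> carrier R"
    then show ra: "r \<otimes>\<^bsub>R\<^esub> a \<in> {r \<in> carrier R. r \<odot>\<^bsub>M\<^esub> x \<in> S}"
      using S'(4) x by (simp add: smult_assoc1)
    show "a \<otimes>\<^bsub>R\<^esub> r \<in> {r \<in> carrier R. r \<odot>\<^bsub>M\<^esub> x \<in> S}"
      using ra a r by (simp add: R.m_comm)
  qed
qed

lemma module_homI:
  assumes "f \<in> carrier M \<rightarrow>\<^sub>E carrier N"
    and "\<And>x y. x \<in> carrier M \<Longrightarrow> y \<in> carrier M \<Longrightarrow> f (x \<oplus>\<^bsub>M\<^esub> y) = f x \<oplus>\<^bsub>N\<^esub> f y"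
    and "\<And>r x. r \<in> carrier R \<Longrightarrow> x \<in> carrier M \<Longrightarrow> f (r \<odot>\<^bsub>M\<^esub> x) = r \<odot>\<^bsub>N\<^esub> f x"
  shows "f \<in> module_hom R M N"
  using assms by (simp add: module_hom_def)

lemma module_hom_eqI:
  assumes "f \<in> module_hom R M N" "g \<in> module_hom R M N"
    and "\<And>x. x \<in> carrier M \<Longrightarrow> f x = g x"
  shows "f = g"
  using assms by (intro PiE_ext[of f "carrier M" "\<lambda>_. carrier N" g]) (auto simp: module_hom_def)

lemma module_hom_zero:
  assumes "module R M" "module R N" "f \<in> module_hom R M N"
  shows "f \<zero>\<^bsub>M\<^esub> = \<zero>\<^bsub>N\<^esub>"
proof -
  interpret M: module R M by fact
  interpret N: module R N by fact
  show ?thesis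
    using module_hom_smult[OF assms(3), of "\<zero>\<^bsub>R\<^esub>" "\<zero>\<^bsub>M\<^esub>"]
      module_hom_closed[OF assms(3), of "\<zero>\<^bsub>M\<^esub>"] by simp
qed

lemma module_hom_diff:
  assumes "module R M" "module R N" "f \<in> module_hom R M N" "x \<in> carrier M" "y \<in> carrier M"
  shows "f (x \<ominus>\<^bsub>M\<^esub> y) = f x \<ominus>\<^bsub>N\<^esub> f y"
proof -
  interpret M: module R M by fact
  interpret N: module R N by fact
  have "f (x \<ominus>\<^bsub>M\<^esub> y) \<oplus>\<^bsub>N\<^esub> f y = f x"
    using module_hom_add[OF assms(3), of "x \<ominus>\<^bsub>M\<^esub> y" y] assms(4,5) by (simp add: M.M.diff_add_cancel)
  moreover note module_hom_closed[OF assms(3), of "x \<ominus>\<^bsub>M\<^esub> y"] module_hom_closed[OF assms(3), of x]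
    module_hom_closed[OF assms(3), of y]
  ultimately show ?thesis
    using assms(4,5) by (metis N.M.add.inv_solve_right M.M.minus_closed N.M.minus_eq)
qed

lemma module_hom_diff_smult:
  assumes "module R M" "module R N" "f \<in> module_hom R M N" "g \<in> module_hom R M N" "r \<in> carrier R"
  shows "(\<lambda>x\<in>carrier M. f x \<ominus>\<^bsub>N\<^esub> r \<odot>\<^bsub>N\<^esub> g x) \<in> module_hom R M N"
proof -
  interpret M: module R M by fact
  interpret N: module R N by fact
  note [simp] = module_hom_closed[OF assms(3)] module_hom_closed[OF assms(4)] assms(5)
    module_hom_add[OF assms(3)] module_hom_add[OF assms(4)]
    module_hom_smult[OF assms(3)] module_hom_smult[OF assms(4)]
  show ?thesis
  proof (rule module_homI)
    fix x y assume "x \<in> carrier M" "y \<in> carrier M"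
    then show "(\<lambda>x\<in>carrier M. f x \<ominus>\<^bsub>N\<^esub> r \<odot>\<^bsub>N\<^esub> g x) (x \<oplus>\<^bsub>M\<^esub> y) =
      (\<lambda>x\<in>carrier M. f x \<ominus>\<^bsub>N\<^esub> r \<odot>\<^bsub>N\<^esub> g x) x \<oplus>\<^bsub>N\<^esub> (\<lambda>x\<in>carrier M. f x \<ominus>\<^bsub>N\<^esub> r \<odot>\<^bsub>N\<^esub> g x) y"
      by (simp add: N.smult_r_distr N.M.minus_eq N.M.minus_add N.M.a_ac)
  next
    fix a x assume "a \<in> carrier R" "x \<in> carrier M"
    then show "(\<lambda>x\<in>carrier M. f x \<ominus>\<^bsub>N\<^esub> r \<odot>\<^bsub>N\<^esub> g x) (a \<odot>\<^bsub>M\<^esub> x) =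
      a \<odot>\<^bsub>N\<^esub> (\<lambda>x\<in>carrier M. f x \<ominus>\<^bsub>N\<^esub> r \<odot>\<^bsub>N\<^esub> g x) x"
      by (simp add: N.smult_diff_right N.smult_comm[of a r])
  qed simp
qed

lemma hom_module_simps [simp]:
  "carrier (hom_module R M N) = module_hom R M N"
  "\<zero>\<^bsub>hom_module R M N\<^esub> = (\<lambda>x\<in>carrier M. \<zero>\<^bsub>N\<^esub>)"
  "f \<oplus>\<^bsub>hom_module R M N\<^esub> g = (\<lambda>x\<in>carrier M. f x \<oplus>\<^bsub>N\<^esub> g x)"
  "r \<odot>\<^bsub>hom_module R M N\<^esub> f = (\<lambda>x\<in>carrier M. r \<odot>\<^bsub>N\<^esub> f x)"
  by (simp_all add: hom_module_def)

lemma module_hom_module: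
  assumes "module R M" "module R N"
  shows "module R (hom_module R M N)"
proof -
  interpret M: module R M by fact
  interpret N: module R N by fact
  have z: "(\<lambda>x\<in>carrier M. \<zero>\<^bsub>N\<^esub>) \<in> module_hom R M N"
    by (rule module_homI) auto
  have s: "(\<lambda>x\<in>carrier M. f x \<oplus>\<^bsub>N\<^esub> g x) \<in> module_hom R M N"
    if f: "f \<in> module_hom R M N" and g: "g \<in> module_hom R M N" for f g
  proof (rule module_homI)
    show "(\<lambda>x\<in>carrier M. f x \<oplus>\<^bsub>N\<^esub> g x) \<in> carrier M \<rightarrow>\<^sub>E carrier N"
      using module_hom_closed[OF f] module_hom_closed[OF g] by auto
  qed (use f g in \<open>simp_all add: module_hom_closed[OF f] module_hom_closed[OF g]
        module_hom_add[OF f] module_hom_add[OF g] module_hom_smult[OF f] module_hom_smult[OF g]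
        N.smult_r_distr N.M.a_ac\<close>)
  have m: "(\<lambda>x\<in>carrier M. r \<odot>\<^bsub>N\<^esub> f x) \<in> module_hom R M N"
    if r: "r \<in> carrier R" and f: "f \<in> module_hom R M N" for r f
    using r module_hom_closed[OF f] module_hom_add[OF f] module_hom_smult[OF f]
    by (intro module_homI) (auto simp: N.smult_r_distr N.smult_comm[of r])
  have ext: "f \<in> extensional (carrier M)" if "f \<in> module_hom R M N" for f
    using that by (simp add: module_hom_def PiE_def)
  have n: "\<exists>g\<in>module_hom R M N. (\<lambda>x\<in>carrier M. g x \<oplus>\<^bsub>N\<^esub> f x) = (\<lambda>x\<in>carrier M. \<zero>\<^bsub>N\<^esub>)"
    if f: "f \<in> module_hom R M N" for f
  proof (rule bexI[OF _ m[OF _ f]])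
    show "(\<lambda>x\<in>carrier M. (\<lambda>x\<in>carrier M. (\<ominus>\<^bsub>R\<^esub> \<one>\<^bsub>R\<^esub>) \<odot>\<^bsub>N\<^esub> f x) x \<oplus>\<^bsub>N\<^esub> f x) = (\<lambda>x\<in>carrier M. \<zero>\<^bsub>N\<^esub>)"
      using module_hom_closed[OF f] by (intro restrict_ext) (simp add: N.smult_l_minus N.M.l_neg)
  qed simp
  show ?thesis
  proof (rule moduleI)
    show "cring R" by (rule M.R.is_cring)
    show "abelian_group (hom_module R M N)"
    proof (rule abelian_groupI)
      fix f g h assume "f \<in> carrier (hom_module R M N)" "g \<in> carrier (hom_module R M N)"
        "h \<in> carrier (hom_module R M N)"
      then show "(f \<oplus>\<^bsub>hom_module R M N\<^esub> g) \<oplus>\<^bsub>hom_module R M N\<^esub> h =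
        f \<oplus>\<^bsub>hom_module R M N\<^esub> (g \<oplus>\<^bsub>hom_module R M N\<^esub> h)"
        using module_hom_closed[of f R M N] module_hom_closed[of g R M N] module_hom_closed[of h R M N]
        by (auto simp: N.M.a_assoc intro!: restrict_ext)
    next
      fix f g assume "f \<in> carrier (hom_module R M N)" "g \<in> carrier (hom_module R M N)"
      then show "f \<oplus>\<^bsub>hom_module R M N\<^esub> g = g \<oplus>\<^bsub>hom_module R M N\<^esub> f"
        using module_hom_closed[of f R M N] module_hom_closed[of g R M N]
        by (auto simp: N.M.a_comm intro!: restrict_ext)
    next
      fix f assume f: "f \<in> carrier (hom_module R M N)"
      then show "\<zero>\<^bsub>hom_module R M N\<^esub> \<oplus>\<^bsub>hom_module R M N\<^esub> f = f"
        using module_hom_closed[of f R M N] ext[of f]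
        by (intro extensionalityI[of _ "carrier M"]) auto
      show "\<exists>g\<in>carrier (hom_module R M N). g \<oplus>\<^bsub>hom_module R M N\<^esub> f = \<zero>\<^bsub>hom_module R M N\<^esub>"
        using n f by simp
    qed (use z s in simp_all)
    fix f assume f: "f \<in> carrier (hom_module R M N)"
    then have fc: "\<And>x. x \<in> carrier M \<Longrightarrow> f x \<in> carrier N" using module_hom_closed[of f R M N] by simp
    show "\<one>\<^bsub>R\<^esub> \<odot>\<^bsub>hom_module R M N\<^esub> f = f"
      using fc ext[of f] f by (intro extensionalityI[of _ "carrier M"]) auto
    fix a assume a: "a \<in> carrier R"
    show "a \<odot>\<^bsub>hom_module R M N\<^esub> f \<in> carrier (hom_module R M N)" using m a f by simp
    show "a \<odot>\<^bsub>hom_module R M N\<^esub> (f \<oplus>\<^bsub>hom_module R M N\<^esub> g) =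
        a \<odot>\<^bsub>hom_module R M N\<^esub> f \<oplus>\<^bsub>hom_module R M N\<^esub> a \<odot>\<^bsub>hom_module R M N\<^esub> g"
      if "g \<in> carrier (hom_module R M N)" for g
      using that fc a module_hom_closed[of g R M N]
      by (auto simp: N.smult_r_distr intro!: restrict_ext)
    fix b assume b: "b \<in> carrier R"
    show "(a \<oplus>\<^bsub>R\<^esub> b) \<odot>\<^bsub>hom_module R M N\<^esub> f =
        a \<odot>\<^bsub>hom_module R M N\<^esub> f \<oplus>\<^bsub>hom_module R M N\<^esub> b \<odot>\<^bsub>hom_module R M N\<^esub> f"
      using fc a b by (auto simp: N.smult_l_distr intro!: restrict_ext)
    show "(a \<otimes>\<^bsub>R\<^esub> b) \<odot>\<^bsub>hom_module R M N\<^esub> f =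
        a \<odot>\<^bsub>hom_module R M N\<^esub> (b \<odot>\<^bsub>hom_module R M N\<^esub> f)"
      using fc a b by (auto simp: N.smult_assoc1 intro!: restrict_ext)
  qed
qed

lemma quotient_module_simps [simp]:
  "carrier (quotient_module M N) = a_rcosets\<^bsub>M\<^esub> N"
  "\<zero>\<^bsub>quotient_module M N\<^esub> = N"
  "c \<oplus>\<^bsub>quotient_module M N\<^esub> d = c <+>\<^bsub>M\<^esub> d"
  "r \<odot>\<^bsub>quotient_module M N\<^esub> c = (\<Union>x\<in>c. N +>\<^bsub>M\<^esub> (r \<odot>\<^bsub>M\<^esub> x))"
  by (simp_all add: quotient_module_def)

lemma (in module) submodule_abelian_subgroup:
  assumes "submodule N R M" shows "abelian_subgroup N M"
proof (rule abelian_subgroupI3)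
  show "additive_subgroup N M"
    using assms by (simp add: additive_subgroup_def submodule_def)
qed (rule M.abelian_group_axioms)

text \<open>The union in the scalar multiplication of a quotient is over equal cosets.\<close>

lemma quotient_smult:
  fixes M :: "('a, 'm) module"
  assumes M: "module R M" and N: "submodule N R M" and x: "x \<in> carrier M" and r: "r \<in> carrier R"
  shows "r \<odot>\<^bsub>quotient_module M N\<^esub> (N +>\<^bsub>M\<^esub> x) = N +>\<^bsub>M\<^esub> (r \<odot>\<^bsub>M\<^esub> x)"
proof -
  interpret module R M by fact
  interpret N: abelian_subgroup N M by (rule submodule_abelian_subgroup[OF N])
  note N' = submoduleE[OF N]
  have eq: "N +>\<^bsub>M\<^esub> (r \<odot>\<^bsub>M\<^esub> y) = N +>\<^bsub>M\<^esub> (r \<odot>\<^bsub>M\<^esub> x)" if y: "y \<in> N +>\<^bsub>M\<^esub> x" for y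
  proof -
    obtain n where n: "n \<in> N" "y = n \<oplus>\<^bsub>M\<^esub> x" using y unfolding a_r_coset_def' by blast
    then have "r \<odot>\<^bsub>M\<^esub> y = r \<odot>\<^bsub>M\<^esub> n \<oplus>\<^bsub>M\<^esub> r \<odot>\<^bsub>M\<^esub> x"
      using x r subsetD[OF N'(1) n(1)] by (simp add: smult_r_distr)
    then have "r \<odot>\<^bsub>M\<^esub> y \<in> N +>\<^bsub>M\<^esub> (r \<odot>\<^bsub>M\<^esub> x)"
      unfolding a_r_coset_def' using N'(4)[OF r n(1)] by blast
    then show ?thesis using N.a_repr_independence'[of "r \<odot>\<^bsub>M\<^esub> y" "r \<odot>\<^bsub>M\<^esub> x"] x r by simp
  qed
  have "(\<Union>y\<in>N +>\<^bsub>M\<^esub> x. N +>\<^bsub>M\<^esub> (r \<odot>\<^bsub>M\<^esub> y)) = (\<Union>y\<in>N +>\<^bsub>M\<^esub> x. N +>\<^bsub>M\<^esub> (r \<odot>\<^bsub>M\<^esub> x))"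
    by (intro SUP_cong refl eq)
  moreover have "N +>\<^bsub>M\<^esub> x \<noteq> {}" using N.a_rcos_self[OF x] by blast
  ultimately show ?thesis by simp
qed

definition annihilator ::
    "('a, 'r) ring_scheme \<Rightarrow> ('a, 'e) module \<Rightarrow> ('a, 'm) module \<Rightarrow> 'm set \<Rightarrow> ('m \<Rightarrow> 'e) set"
  where "annihilator R E M N = {f \<in> module_hom R M E. \<forall>x\<in>N. f x = \<zero>\<^bsub>E\<^esub>}"

definition common_kernel :: "('a, 'e) module \<Rightarrow> ('a, 'm) module \<Rightarrow> ('m \<Rightarrow> 'e) set \<Rightarrow> 'm set"
  where "common_kernel E M L = {x \<in> carrier M. \<forall>f\<in>L. f x = \<zero>\<^bsub>E\<^esub>}"

text \<open>The functionals on \<open>M/N\<close> are those on \<open>M\<close> that vanish on \<open>N\<close>; this removes cosets from all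
  later arguments about duals of quotients.\<close>

lemma dual_quotient_eq_annihilator:
  assumes M: "module R M" and E: "module R E" and N: "submodule N R M"
  shows "dual_quotient R E M N = annihilator R E M N"
proof (intro equalityI subsetI)
  interpret M: module R M by fact
  interpret E: module R E by fact
  interpret N: abelian_subgroup N M by (rule M.submodule_abelian_subgroup[OF N])
  note NM = M.submoduleE(1)[OF N]
  have cos: "N +>\<^bsub>M\<^esub> x \<in> a_rcosets\<^bsub>M\<^esub> N" if "x \<in> carrier M" for x
    using that NM by (simp add: M.a_rcosetsI)
  {
    fix f assume "f \<in> dual_quotient R E M N"
    then obtain g where g: "g \<in> module_hom R (quotient_module M N) E"
      and f: "f = (\<lambda>x\<in>carrier M. g (N +>\<^bsub>M\<^esub> x))"
      by (auto simp: dual_quotient_def)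
    have hom: "f \<in> module_hom R M E"
    proof (rule module_homI)
      show "f \<in> carrier M \<rightarrow>\<^sub>E carrier E"
        using module_hom_closed[OF g] cos by (auto simp: f)
      show "f (x \<oplus>\<^bsub>M\<^esub> y) = f x \<oplus>\<^bsub>E\<^esub> f y" if "x \<in> carrier M" "y \<in> carrier M" for x y
        using module_hom_add[OF g, of "N +>\<^bsub>M\<^esub> x" "N +>\<^bsub>M\<^esub> y"] that cos
        by (simp add: f N.a_rcos_sum)
      show "f (r \<odot>\<^bsub>M\<^esub> x) = r \<odot>\<^bsub>E\<^esub> f x" if "r \<in> carrier R" "x \<in> carrier M" for r x
        using module_hom_smult[OF g, of r "N +>\<^bsub>M\<^esub> x"] that cos quotient_smult[OF M N that(2,1)]
        by (simp add: f del: quotient_module_simps(4))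
    qed
    moreover have "f x = \<zero>\<^bsub>E\<^esub>" if x: "x \<in> N" for x
    proof -
      have "f x = f \<zero>\<^bsub>M\<^esub>"
        using x NM by (simp add: f subset_iff N.a_rcos_const M.submodule_zero[OF N])
      then show ?thesis using module_hom_zero[OF M E hom] by simp
    qed
    ultimately show "f \<in> annihilator R E M N" by (simp add: annihilator_def)
  next
    fix f assume "f \<in> annihilator R E M N"
    then have f: "f \<in> module_hom R M E" and fN: "\<And>x. x \<in> N \<Longrightarrow> f x = \<zero>\<^bsub>E\<^esub>"
      by (auto simp: annihilator_def)
    define g where "g = (\<lambda>c\<in>a_rcosets\<^bsub>M\<^esub> N. f (SOME x. x \<in> c))"
    have g: "g (N +>\<^bsub>M\<^esub> x) = f x" if x: "x \<in> carrier M" for x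
    proof -
      have "(SOME y. y \<in> N +>\<^bsub>M\<^esub> x) \<in> N +>\<^bsub>M\<^esub> x"
        using N.a_rcos_self[OF x] by (rule someI)
      then obtain n where n: "n \<in> N" "(SOME y. y \<in> N +>\<^bsub>M\<^esub> x) = n \<oplus>\<^bsub>M\<^esub> x"
        unfolding a_r_coset_def' by blast
      then show ?thesis
        using cos[OF x] fN[OF n(1)] x NM module_hom_add[OF f, of n x] module_hom_closed[OF f x]
        by (auto simp: g_def)
    qed
    have rep: "\<exists>x\<in>carrier M. c = N +>\<^bsub>M\<^esub> x" if "c \<in> a_rcosets\<^bsub>M\<^esub> N" for c
      using that by (auto simp: A_RCOSETS_def')
    have "g \<in> module_hom R (quotient_module M N) E"
    proof (rule module_homI)
      show "g \<in> carrier (quotient_module M N) \<rightarrow>\<^sub>E carrier E"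
      proof (rule PiE_I)
        show "g c \<in> carrier E" if "c \<in> carrier (quotient_module M N)" for c
          using rep[of c] that g module_hom_closed[OF f] by auto
      qed (simp add: g_def)
      fix c assume "c \<in> carrier (quotient_module M N)"
      then obtain x where x: "x \<in> carrier M" "c = N +>\<^bsub>M\<^esub> x" using rep by auto
      show "g (r \<odot>\<^bsub>quotient_module M N\<^esub> c) = r \<odot>\<^bsub>E\<^esub> g c" if r: "r \<in> carrier R" for r
        using quotient_smult[OF M N x(1) r] g module_hom_smult[OF f r] x r
        by (simp del: quotient_module_simps(4))
      fix d assume "d \<in> carrier (quotient_module M N)"
      then obtain y where y: "y \<in> carrier M" "d = N +>\<^bsub>M\<^esub> y" using rep by auto
      show "g (c \<oplus>\<^bsub>quotient_module M N\<^esub> d) = g c \<oplus>\<^bsub>E\<^esub> g d"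
        using x y g module_hom_add[OF f] by (simp add: N.a_rcos_sum)
    qed
    moreover have "f = (\<lambda>x\<in>carrier M. g (N +>\<^bsub>M\<^esub> x))"
      using g f by (intro extensionalityI[of _ "carrier M"]) (simp_all add: module_hom_def PiE_def)
    ultimately show "f \<in> dual_quotient R E M N" by (auto simp: dual_quotient_def)
  }
qed

lemma submodule_annihilator:
  assumes M: "module R M" and E: "module R E" and N: "N \<subseteq> carrier M"
  shows "submodule (annihilator R E M N) R (hom_module R M E)"
proof -
  interpret E: module R E by fact
  interpret H: module R "hom_module R M E" by (rule module_hom_module[OF M E])
  have sm: "r \<odot>\<^bsub>hom_module R M E\<^esub> f \<in> annihilator R E M N"
    if "r \<in> carrier R" "f \<in> annihilator R E M N" for r f
    using that H.smult_closed[of r f] N by (auto simp: annihilator_def)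
  show ?thesis
  proof (rule H.submoduleI)
    show "annihilator R E M N \<subseteq> carrier (hom_module R M E)" by (auto simp: annihilator_def)
    show "\<zero>\<^bsub>hom_module R M E\<^esub> \<in> annihilator R E M N"
      using H.M.zero_closed N by (auto simp: annihilator_def)
    show "f \<oplus>\<^bsub>hom_module R M E\<^esub> g \<in> annihilator R E M N"
      if "f \<in> annihilator R E M N" "g \<in> annihilator R E M N" for f g
      using that H.M.add.m_closed[of f g] N by (auto simp: annihilator_def)
    show "\<ominus>\<^bsub>hom_module R M E\<^esub> f \<in> annihilator R E M N" if f: "f \<in> annihilator R E M N" for f
    proof -
      have fc: "f \<in> carrier (hom_module R M E)" using f by (simp add: annihilator_def)
      then have "\<ominus>\<^bsub>hom_module R M E\<^esub> f = (\<ominus>\<^bsub>R\<^esub> \<one>\<^bsub>R\<^esub>) \<odot>\<^bsub>hom_module R M E\<^esub> f"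
        using H.smult_l_minus[OF E.R.one_closed fc] H.smult_one[OF fc] by (simp del: hom_module_simps)
      then show ?thesis using sm[OF _ f, of "\<ominus>\<^bsub>R\<^esub> \<one>\<^bsub>R\<^esub>"] by (simp del: hom_module_simps)
    qed
  qed (rule sm)
qed

lemma submodule_common_kernel:
  assumes M: "module R M" and E: "module R E" and L: "L \<subseteq> module_hom R M E"
  shows "submodule (common_kernel E M L) R M"
proof -
  interpret M: module R M by fact
  interpret E: module R E by fact
  have L': "f \<in> module_hom R M E" if "f \<in> L" for f using L that by blast
  show ?thesis
  proof (rule M.submoduleI)
    show "\<ominus>\<^bsub>M\<^esub> x \<in> common_kernel E M L" if x: "x \<in> common_kernel E M L" for x
    proof -
      have xM: "x \<in> carrier M" using x by (simp add: common_kernel_def)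
      have "f (\<ominus>\<^bsub>M\<^esub> x) = \<zero>\<^bsub>E\<^esub>" if f: "f \<in> L" for f
      proof -
        have "f x = \<zero>\<^bsub>E\<^esub>" using x f by (simp add: common_kernel_def)
        then have "f ((\<ominus>\<^bsub>R\<^esub> \<one>\<^bsub>R\<^esub>) \<odot>\<^bsub>M\<^esub> x) = \<zero>\<^bsub>E\<^esub>"
          using xM by (simp add: module_hom_smult[OF L'[OF f]])
        then show ?thesis using xM by (simp add: M.smult_l_minus)
      qed
      then show ?thesis using xM by (simp add: common_kernel_def)
    qed
    show "\<zero>\<^bsub>M\<^esub> \<in> common_kernel E M L"
      using module_hom_zero[OF M E L'] by (simp add: common_kernel_def)
    have car: "x \<in> carrier M" and ker: "\<And>f. f \<in> L \<Longrightarrow> f x = \<zero>\<^bsub>E\<^esub>" if "x \<in> common_kernel E M L" for x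
      using that by (simp_all add: common_kernel_def)
    show "x \<oplus>\<^bsub>M\<^esub> y \<in> common_kernel E M L"
      if x: "x \<in> common_kernel E M L" and y: "y \<in> common_kernel E M L" for x y
    proof -
      have "f (x \<oplus>\<^bsub>M\<^esub> y) = \<zero>\<^bsub>E\<^esub>" if "f \<in> L" for f
        using module_hom_add[OF L'[OF that] car[OF x] car[OF y]] ker[OF x that] ker[OF y that] by simp
      then show ?thesis using car[OF x] car[OF y] by (simp add: common_kernel_def)
    qed
    show "r \<odot>\<^bsub>M\<^esub> x \<in> common_kernel E M L"
      if r: "r \<in> carrier R" and x: "x \<in> common_kernel E M L" for r x
    proof -
      have "f (r \<odot>\<^bsub>M\<^esub> x) = \<zero>\<^bsub>E\<^esub>" if "f \<in> L" for f
        using module_hom_smult[OF L'[OF that] r car[OF x]] ker[OF x that] r by simp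
      then show ?thesis using car[OF x] r by (simp add: common_kernel_def)
    qed
  qed (simp add: common_kernel_def subset_iff)
qed


section \<open>The maximal ideal and its powers\<close>

lemma (in noetherian_ring) exists_maximal_ideal_in_family:
  assumes "F \<noteq> {}" and F: "\<And>I. I \<in> F \<Longrightarrow> ideal I R"
  shows "\<exists>I\<in>F. \<forall>J\<in>F. I \<subseteq> J \<longrightarrow> J = I"
proof (rule subset_Zorn_nonempty)
  fix C assume C: "C \<noteq> {}" "subset.chain F C"
  then have "subset.chain {I. ideal I R} C"
    using F by (auto simp: subset_chain_def)
  then show "\<Union>C \<in> F"
    using ideal_chain_is_trivial[OF C(1)] C(2) by (auto simp: subset_chain_def)
qed fact

lemma (in noetherian_ring) ascending_ideals_stabilize:
  assumes J: "\<And>n::nat. ideal (J n) R" and "\<And>n. J n \<subseteq> J (Suc n)"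
  shows "\<exists>N. \<forall>n. J n \<subseteq> J N"
proof -
  have mono: "J p \<subseteq> J q" if "p \<le> q" for p q using lift_Suc_mono_le[of J] assms(2) that by blast
  have "subset.chain {I. ideal I R} (range J)"
    unfolding subset_chain_def using J mono nat_le_linear by blast
  then have "\<Union>(range J) \<in> range J" by (intro ideal_chain_is_trivial) auto
  then show ?thesis by blast
qed

context complete_noetherian_local_ring
begin

abbreviation max_power :: "nat \<Rightarrow> 'a set"
  where "max_power n \<equiv> \<mm> [^]\<^bsub>ideals_set R\<^esub> n"

lemma max_ideal: "ideal \<mm> R"
  using maximalideal by (rule maximalideal.axioms(1))

lemma proper_ideal_in_max:
  assumes I: "ideal I R" and proper: "\<one> \<notin> I"
  shows "I \<subseteq> \<mm>"
proof -
  define F where "F = {J. ideal J R \<and> I \<subseteq> J \<and> \<one> \<notin> J}"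
  have IF: "I \<in> F" using assms by (simp add: F_def)
  have "\<exists>J\<in>F. \<forall>K\<in>F. J \<subseteq> K \<longrightarrow> K = J"
    by (rule exists_maximal_ideal_in_family) (use IF in \<open>auto simp: F_def\<close>)
  then obtain J where JF: "J \<in> F" and max: "\<And>K. K \<in> F \<Longrightarrow> J \<subseteq> K \<Longrightarrow> K = J" by auto
  have J: "ideal J R" "I \<subseteq> J" "\<one> \<notin> J" using JF by (simp_all add: F_def)
  have "maximalideal J R"
  proof (rule maximalidealI)
    show "carrier R \<noteq> J" using J(3) one_closed by blast
    fix K assume K: "ideal K R" "J \<subseteq> K" "K \<subseteq> carrier R"
    show "K = J \<or> K = carrier R"
    proof (cases "\<one> \<in> K")
      case True
      then show ?thesis using ideal.one_imp_carrier[OF K(1)] by simp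
    next
      case False
      then have "K \<in> F" using K J(2) by (simp add: F_def)
      then show ?thesis using max K(2) by simp
    qed
  qed fact
  then show ?thesis using maximalideal_unique J(2) by simp
qed

lemma unit_if_not_in_max:
  assumes r: "r \<in> carrier R" and nm: "r \<notin> \<mm>"
  shows "\<exists>s\<in>carrier R. s \<otimes> r = \<one>"
proof -
  have "\<one> \<in> PIdl r"
    using proper_ideal_in_max[OF cgenideal_ideal[OF r]] cgenideal_self[OF r] nm by blast
  then show ?thesis by (auto simp: cgenideal_def)
qed

lemma max_power_0: "max_power 0 = carrier R"
  and max_power_Suc: "max_power (Suc n) = max_power n \<cdot> \<mm>"
proof -
  have "\<one>\<^bsub>ideals_set R\<^esub> = carrier R" "I \<otimes>\<^bsub>ideals_set R\<^esub> J = I \<cdot> J" for I J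
    by (simp_all add: ideals_set_def)
  then show "max_power 0 = carrier R" "max_power (Suc n) = max_power n \<cdot> \<mm>"
    by (simp_all add: nat_pow_def)
qed

lemma max_power_ideal: "ideal (max_power n) R"
proof (induction n)
  case 0
  show ?case unfolding max_power_0 by (rule oneideal)
next
  case (Suc n)
  then show ?case unfolding max_power_Suc by (rule ideal_prod_is_ideal[OF _ max_ideal])
qed

lemma max_power_subset: "max_power n \<subseteq> carrier R"
  using ideal.Icarr[OF max_power_ideal] by blast

lemma max_power_decseq: "n \<le> k \<Longrightarrow> max_power k \<subseteq> max_power n"
proof (rule lift_Suc_antimono_le[of max_power])
  show "max_power (Suc i) \<subseteq> max_power i" for i
    using ideal_prod_inter[OF max_power_ideal max_ideal, of i] unfolding max_power_Suc by blast
qed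

lemma ideal_diff: "ideal I R \<Longrightarrow> a \<in> I \<Longrightarrow> b \<in> I \<Longrightarrow> a \<ominus> b \<in> I"
  by (simp add: a_minus_def additive_subgroup.a_closed additive_subgroup.a_inv_closed ideal.axioms(1))

end


section \<open>The injective hull of the residue field\<close>

text \<open>
  An injective hull of the residue field is an injective module whose socle is simple and
  essential.  The assumptions on \<open>e\<close>, which generates the socle, express this in terms of elements,
  so that no isomorphism with \<open>R/\<mm>\<close> has to be carried along.
\<close>

locale residue_hull = complete_noetherian_local_ring R \<mm>
  for R :: "('a, 'r) ring_scheme" (structure) and \<mm> +
  fixes E :: "('a, 'e) module" and e :: 'e
  assumes inj: "injective_module R E"
    and e_closed: "e \<in> carrier E" and e_nonzero: "e \<noteq> \<zero>\<^bsub>E\<^esub>"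
    and max_smult_e: "\<And>r. r \<in> \<mm> \<Longrightarrow> r \<odot>\<^bsub>E\<^esub> e = \<zero>\<^bsub>E\<^esub>"
    and essential: "\<And>x. x \<in> carrier E \<Longrightarrow> x \<noteq> \<zero>\<^bsub>E\<^esub> \<Longrightarrow> \<exists>s\<in>carrier R. s \<odot>\<^bsub>E\<^esub> x = e"

lemma injective_hull_residue_hull:
  fixes R :: "('a, 'r) ring_scheme" and E :: "('a, 'e) module"
  assumes R: "complete_noetherian_local_ring R \<mm>"
    and hull: "injective_hull R (residue_module R \<mm>) E"
  shows "\<exists>e. residue_hull R \<mm> E e"
proof -
  interpret complete_noetherian_local_ring R \<mm> by fact
  have inj: "injective_module R E" using hull by (simp add: injective_hull_def)
  interpret E: module R E using inj by (simp add: injective_module_def)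
  let ?Q = "quotient_module (regular_module R) \<mm>"
  obtain j where j: "j \<in> module_hom R ?Q E" and jinj: "inj_on j (carrier ?Q)"
    and ess: "\<And>S. submodule S R E \<Longrightarrow> S \<inter> j ` carrier ?Q = {\<zero>\<^bsub>E\<^esub>} \<Longrightarrow> S = {\<zero>\<^bsub>E\<^esub>}"
    using hull by (auto simp: injective_hull_def residue_module_def)
  have regm: "module R (regular_module R)" by (rule module_regular_module[OF is_cring])
  interpret RM: module R "regular_module R" by fact
  have reg [simp]: "carrier (regular_module R) = carrier R" "add (regular_module R) = add R"
    "r \<odot>\<^bsub>regular_module R\<^esub> x = r \<otimes>\<^bsub>R\<^esub> x" "\<zero>\<^bsub>regular_module R\<^esub> = \<zero>\<^bsub>R\<^esub>" for r x
    by (simp_all add: regular_module_def)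
  have coset: "\<mm> +>\<^bsub>regular_module R\<^esub> x = \<mm> +>\<^bsub>R\<^esub> x" for x
    by (simp add: a_r_coset_def')
  have cosets: "carrier ?Q = (\<lambda>x. \<mm> +>\<^bsub>R\<^esub> x) ` carrier R"
    by (auto simp: A_RCOSETS_def' a_r_coset_def')
  have sub: "submodule \<mm> R (regular_module R)"
  proof (rule RM.submoduleI)
    interpret m: ideal \<mm> R by (rule max_ideal)
    show "\<ominus>\<^bsub>regular_module R\<^esub> a \<in> \<mm>" if "a \<in> \<mm>" for a
    proof -
      have "\<ominus>\<^bsub>regular_module R\<^esub> a = \<ominus>\<^bsub>R\<^esub> a" by (simp add: a_inv_def m_inv_def)
      then show ?thesis using that by simp
    qed
  qed (use max_ideal in \<open>auto simp: ideal.Icarr additive_subgroup.zero_closed additive_subgroup.a_closed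
        ideal.I_l_closed ideal.axioms(1)\<close>)
  have smult: "r \<odot>\<^bsub>?Q\<^esub> (\<mm> +>\<^bsub>R\<^esub> x) = \<mm> +>\<^bsub>R\<^esub> (r \<otimes>\<^bsub>R\<^esub> x)" if "r \<in> carrier R" "x \<in> carrier R" for r x
    using quotient_smult[OF regm sub, of x r] that by (simp add: coset del: quotient_module_simps(4))
  interpret m: ideal \<mm> R by (rule max_ideal)
  have one_m: "\<one>\<^bsub>R\<^esub> \<notin> \<mm>"
    using m.one_imp_carrier maximalideal.I_notcarr[OF maximalideal] by blast
  define e where "e = j (\<mm> +>\<^bsub>R\<^esub> \<one>\<^bsub>R\<^esub>)"
  have cl: "\<mm> +>\<^bsub>R\<^esub> x \<in> carrier ?Q" if "x \<in> carrier R" for x using that unfolding cosets by blast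
  have jr: "j (\<mm> +>\<^bsub>R\<^esub> r) = r \<odot>\<^bsub>E\<^esub> e" if r: "r \<in> carrier R" for r
    using module_hom_smult[OF j r cl[OF one_closed]] smult[OF r one_closed] r
    by (simp add: e_def del: quotient_module_simps)
  have e: "e \<in> carrier E" using module_hom_closed[OF j cl[OF one_closed]] by (simp add: e_def)
  have null: "r \<odot>\<^bsub>E\<^esub> e = \<zero>\<^bsub>E\<^esub> \<longleftrightarrow> r \<in> \<mm>" if r: "r \<in> carrier R" for r
  proof -
    have "r \<odot>\<^bsub>E\<^esub> e = \<zero>\<^bsub>E\<^esub> \<longleftrightarrow> j (\<mm> +>\<^bsub>R\<^esub> r) = j (\<mm> +>\<^bsub>R\<^esub> \<zero>\<^bsub>R\<^esub>)"
      using jr[OF r] jr[OF zero_closed] e by simp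
    also have "\<dots> \<longleftrightarrow> \<mm> +>\<^bsub>R\<^esub> r = \<mm> +>\<^bsub>R\<^esub> \<zero>\<^bsub>R\<^esub>"
      using inj_on_eq_iff[OF jinj cl[OF r] cl[OF zero_closed]] .
    also have "\<dots> \<longleftrightarrow> r \<in> \<mm>"
      using quotient_eq_iff_same_a_r_cos[OF max_ideal r zero_closed] r by (simp add: a_minus_def)
    finally show ?thesis .
  qed
  have ess': "\<exists>s\<in>carrier R. s \<odot>\<^bsub>E\<^esub> x = e" if x: "x \<in> carrier E" "x \<noteq> \<zero>\<^bsub>E\<^esub>" for x
  proof -
    let ?S = "(\<lambda>r. r \<odot>\<^bsub>E\<^esub> x) ` carrier R"
    have S: "submodule ?S R E"
    proof (rule E.submoduleI)
      show "\<zero>\<^bsub>E\<^esub> \<in> ?S" using x by (intro image_eqI[of _ _ "\<zero>\<^bsub>R\<^esub>"]) auto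
      show "\<ominus>\<^bsub>E\<^esub> a \<in> ?S" if a: "a \<in> ?S" for a
      proof -
        obtain r where "r \<in> carrier R" "a = r \<odot>\<^bsub>E\<^esub> x" using a by blast
        then show ?thesis using x by (intro image_eqI[of _ _ "\<ominus>\<^bsub>R\<^esub> r"]) (auto simp: E.smult_l_minus)
      qed
      show "a \<oplus>\<^bsub>E\<^esub> b \<in> ?S" if ab: "a \<in> ?S" "b \<in> ?S" for a b
      proof -
        obtain r s where "r \<in> carrier R" "a = r \<odot>\<^bsub>E\<^esub> x" "s \<in> carrier R" "b = s \<odot>\<^bsub>E\<^esub> x"
          using ab by blast
        then show ?thesis using x by (intro image_eqI[of _ _ "r \<oplus>\<^bsub>R\<^esub> s"]) (auto simp: E.smult_l_distr)
      qed
      show "a \<odot>\<^bsub>E\<^esub> b \<in> ?S" if a: "a \<in> carrier R" and b: "b \<in> ?S" for a b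
      proof -
        obtain r where "r \<in> carrier R" "b = r \<odot>\<^bsub>E\<^esub> x" using b by blast
        then show ?thesis using x a by (intro image_eqI[of _ _ "a \<otimes>\<^bsub>R\<^esub> r"]) (auto simp: E.smult_assoc1)
      qed
    qed (use x in auto)
    have "x \<in> ?S" using x by (intro image_eqI[of _ _ "\<one>\<^bsub>R\<^esub>"]) auto
    then have "?S \<inter> j ` carrier ?Q \<noteq> {\<zero>\<^bsub>E\<^esub>}" using ess[OF S] x by blast
    moreover have "\<zero>\<^bsub>E\<^esub> \<in> j ` carrier ?Q"
      by (rule image_eqI[OF _ cl[OF zero_closed]]) (use jr[of "\<zero>\<^bsub>R\<^esub>"] e in simp)
    ultimately obtain y where y: "y \<in> ?S" "y \<in> j ` carrier ?Q" "y \<noteq> \<zero>\<^bsub>E\<^esub>"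
      using E.submodule_zero[OF S] by blast
    obtain s where s: "s \<in> carrier R" "y = s \<odot>\<^bsub>E\<^esub> x" using y(1) by blast
    obtain t where t: "t \<in> carrier R" "y = t \<odot>\<^bsub>E\<^esub> e"
      using y(2) jr unfolding cosets by auto
    have "t \<notin> \<mm>" using null t y(3) by blast
    then obtain u where u: "u \<in> carrier R" "u \<otimes>\<^bsub>R\<^esub> t = \<one>\<^bsub>R\<^esub>" using unit_if_not_in_max t by blast
    have "(u \<otimes>\<^bsub>R\<^esub> s) \<odot>\<^bsub>E\<^esub> x = u \<odot>\<^bsub>E\<^esub> (t \<odot>\<^bsub>E\<^esub> e)"
      using u s t x by (simp add: E.smult_assoc1)
    also have "\<dots> = e" using u t e by (simp add: E.smult_assoc1[symmetric])
    finally show ?thesis using u s by blast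
  qed
  have "residue_hull R \<mm> E e"
    using inj e null[OF one_closed] one_m null ess' m.Icarr
    by unfold_locales auto
  then show ?thesis ..
qed


context residue_hull
begin

interpretation E: module R E
  using inj by (simp add: injective_module_def)

lemma module_E: "module R E" ..

text \<open>
  The homomorphism is \<open>n + r x \<mapsto> r e\<close> on \<open>N + R x\<close>, extended by injectivity: it is well-defined
  because the proper ideal \<open>(N : x)\<close> lies in \<open>\<mm>\<close>, which kills \<open>e\<close>.
\<close>

lemma cogenerator:
  fixes M :: "('a, 'm) module"
  assumes M: "module R M" and N: "submodule N R M" and x: "x \<in> carrier M" "x \<notin> N"
  shows "\<exists>f\<in>module_hom R M E. (\<forall>y\<in>N. f y = \<zero>\<^bsub>E\<^esub>) \<and> f x \<noteq> \<zero>\<^bsub>E\<^esub>"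
proof -
  interpret M: module R M by fact
  note N' = M.submoduleE[OF N]
  have NM: "y \<in> carrier M" if "y \<in> N" for y using N'(1) that by blast
  define Q where "Q y r \<longleftrightarrow> r \<in> carrier R \<and> y \<ominus>\<^bsub>M\<^esub> r \<odot>\<^bsub>M\<^esub> x \<in> N" for y r
  define S where "S = {y \<in> carrier M. \<exists>r. Q y r}"
  define h where "h = (\<lambda>y\<in>S. (SOME r. Q y r) \<odot>\<^bsub>E\<^esub> e)"
  have colon: "{r \<in> carrier R. r \<odot>\<^bsub>M\<^esub> x \<in> N} \<subseteq> \<mm>"
    using proper_ideal_in_max[OF M.colon_element_ideal[OF N x(1)]] x by simp
  have h: "h y = r \<odot>\<^bsub>E\<^esub> e" if y: "y \<in> carrier M" and r: "Q y r" for y r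
  proof -
    define s where "s = (SOME r. Q y r)"
    have s: "Q y s" unfolding s_def using r by (rule someI)
    have c: "r \<in> carrier R" "s \<in> carrier R" using r s by (simp_all add: Q_def)
    have "(y \<ominus>\<^bsub>M\<^esub> r \<odot>\<^bsub>M\<^esub> x) \<ominus>\<^bsub>M\<^esub> (y \<ominus>\<^bsub>M\<^esub> s \<odot>\<^bsub>M\<^esub> x) \<in> N"
      using r s by (simp add: Q_def M.submodule_diff[OF N])
    also have "(y \<ominus>\<^bsub>M\<^esub> r \<odot>\<^bsub>M\<^esub> x) \<ominus>\<^bsub>M\<^esub> (y \<ominus>\<^bsub>M\<^esub> s \<odot>\<^bsub>M\<^esub> x) = (s \<ominus> r) \<odot>\<^bsub>M\<^esub> x"
      using c x y by (simp add: M.smult_diff_left M.M.minus_eq M.M.minus_add M.M.a_ac M.M.r_neg2)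
    finally have "s \<ominus> r \<in> \<mm>" using colon c by auto
    then have "s \<odot>\<^bsub>E\<^esub> e \<ominus>\<^bsub>E\<^esub> r \<odot>\<^bsub>E\<^esub> e = \<zero>\<^bsub>E\<^esub>"
      using max_smult_e c e_closed by (simp add: E.smult_diff_left[symmetric])
    then have "s \<odot>\<^bsub>E\<^esub> e = r \<odot>\<^bsub>E\<^esub> e" using c e_closed by (simp add: E.M.diff_eq_zero_iff)
    moreover have "y \<in> S" using y r by (auto simp: S_def)
    ultimately show ?thesis by (simp add: h_def s_def)
  qed
  have Qadd: "Q (y \<oplus>\<^bsub>M\<^esub> z) (r \<oplus> s)" if "y \<in> carrier M" "z \<in> carrier M" "Q y r" "Q z s" for y z r s
  proof -
    have "(y \<ominus>\<^bsub>M\<^esub> r \<odot>\<^bsub>M\<^esub> x) \<oplus>\<^bsub>M\<^esub> (z \<ominus>\<^bsub>M\<^esub> s \<odot>\<^bsub>M\<^esub> x) = (y \<oplus>\<^bsub>M\<^esub> z) \<ominus>\<^bsub>M\<^esub> (r \<oplus> s) \<odot>\<^bsub>M\<^esub> x"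
      using that x by (simp add: Q_def M.smult_l_distr M.M.minus_eq M.M.minus_add M.M.a_ac)
    then show ?thesis using N'(5)[of "y \<ominus>\<^bsub>M\<^esub> r \<odot>\<^bsub>M\<^esub> x" "z \<ominus>\<^bsub>M\<^esub> s \<odot>\<^bsub>M\<^esub> x"] that by (simp add: Q_def)
  qed
  have Qsmult: "Q (a \<odot>\<^bsub>M\<^esub> y) (a \<otimes> r)" if "y \<in> carrier M" "a \<in> carrier R" "Q y r" for y a r
  proof -
    have "a \<odot>\<^bsub>M\<^esub> (y \<ominus>\<^bsub>M\<^esub> r \<odot>\<^bsub>M\<^esub> x) = a \<odot>\<^bsub>M\<^esub> y \<ominus>\<^bsub>M\<^esub> (a \<otimes> r) \<odot>\<^bsub>M\<^esub> x"
      using that x by (simp add: Q_def M.smult_diff_right M.smult_assoc1)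
    then show ?thesis using N'(4)[of a "y \<ominus>\<^bsub>M\<^esub> r \<odot>\<^bsub>M\<^esub> x"] that by (simp add: Q_def)
  qed
  have QN: "Q y \<zero>" if "y \<in> N" for y
    using that NM[OF that] x M.submodule_diff[OF N that M.submodule_zero[OF N]] by (simp add: Q_def)
  have Qx: "Q x \<one>"
    using x M.submodule_zero[OF N] by (simp add: Q_def M.M.minus_eq M.M.r_neg)
  have S: "submodule S R M"
  proof (rule M.submoduleI)
    show "S \<subseteq> carrier M" by (auto simp: S_def)
    show "\<zero>\<^bsub>M\<^esub> \<in> S" using QN[OF M.submodule_zero[OF N]] by (auto simp: S_def)
    show "y \<oplus>\<^bsub>M\<^esub> z \<in> S" if "y \<in> S" "z \<in> S" for y z
      using that Qadd unfolding S_def by blast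
    show sm: "a \<odot>\<^bsub>M\<^esub> y \<in> S" if "a \<in> carrier R" "y \<in> S" for a y
      using that Qsmult unfolding S_def by blast
    show "\<ominus>\<^bsub>M\<^esub> y \<in> S" if y: "y \<in> S" for y
    proof -
      have "y \<in> carrier M" using y by (simp add: S_def)
      then show ?thesis using sm[of "\<ominus> \<one>" y] y by (simp add: M.smult_l_minus)
    qed
  qed
  have "h \<in> module_hom R (M\<lparr>carrier := S\<rparr>) E"
  proof (rule module_homI)
    show "h \<in> carrier (M\<lparr>carrier := S\<rparr>) \<rightarrow>\<^sub>E carrier E"
    proof (rule PiE_I)
      fix y assume "y \<in> carrier (M\<lparr>carrier := S\<rparr>)"
      then obtain r where "y \<in> carrier M" "Q y r" by (auto simp: S_def)
      then show "h y \<in> carrier E" using h e_closed by (simp add: Q_def)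
    qed (simp add: h_def)
    fix y assume "y \<in> carrier (M\<lparr>carrier := S\<rparr>)"
    then obtain r where y: "y \<in> carrier M" "Q y r" by (auto simp: S_def)
    then have r: "r \<in> carrier R" by (simp add: Q_def)
    show "h (a \<odot>\<^bsub>M\<lparr>carrier := S\<rparr>\<^esub> y) = a \<odot>\<^bsub>E\<^esub> h y" if a: "a \<in> carrier R" for a
      using h[OF _ Qsmult[OF y(1) a y(2)]] h[OF y] y a r e_closed by (simp add: E.smult_assoc1)
    fix z assume "z \<in> carrier (M\<lparr>carrier := S\<rparr>)"
    then obtain s where z: "z \<in> carrier M" "Q z s" by (auto simp: S_def)
    then have s: "s \<in> carrier R" by (simp add: Q_def)
    show "h (y \<oplus>\<^bsub>M\<lparr>carrier := S\<rparr>\<^esub> z) = h y \<oplus>\<^bsub>E\<^esub> h z"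
      using h[OF _ Qadd[OF y(1) z(1) y(2) z(2)]] h[OF y] h[OF z] y z r s e_closed
      by (simp add: E.smult_l_distr)
  qed
  then obtain f where f: "f \<in> module_hom R M E" "\<And>y. y \<in> S \<Longrightarrow> f y = h y"
    using injective_module_extend[OF inj M S] by blast
  have "f y = \<zero>\<^bsub>E\<^esub>" if "y \<in> N" for y
  proof -
    have "y \<in> S" using QN[OF that] NM[OF that] by (auto simp: S_def)
    then show ?thesis using f(2) h[OF NM[OF that] QN[OF that]] e_closed by simp
  qed
  moreover have "f x \<noteq> \<zero>\<^bsub>E\<^esub>"
  proof -
    have "x \<in> S" using Qx x by (auto simp: S_def)
    then show ?thesis using f(2) h[OF x(1) Qx] e_closed e_nonzero by simp
  qed
  ultimately show ?thesis using f(1) by blast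
qed

definition torsion :: "nat \<Rightarrow> 'e set"
  where "torsion n = {x \<in> carrier E. \<forall>a\<in>max_power n. a \<odot>\<^bsub>E\<^esub> x = \<zero>\<^bsub>E\<^esub>}"

lemma torsionD: "x \<in> torsion n \<Longrightarrow> a \<in> max_power n \<Longrightarrow> a \<odot>\<^bsub>E\<^esub> x = \<zero>\<^bsub>E\<^esub>"
  and torsion_closed: "x \<in> torsion n \<Longrightarrow> x \<in> carrier E"
  by (simp_all add: torsion_def)

lemma submodule_torsion: "submodule (torsion n) R E"
proof (rule E.submoduleI)
  have mp: "a \<in> carrier R" if "a \<in> max_power n" for a using max_power_subset that by blast
  show "torsion n \<subseteq> carrier E" by (auto simp: torsion_def)
  show "\<zero>\<^bsub>E\<^esub> \<in> torsion n" using mp by (simp add: torsion_def)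
  show "\<ominus>\<^bsub>E\<^esub> x \<in> torsion n" if "x \<in> torsion n" for x
    using that mp by (simp add: torsion_def E.smult_r_minus)
  show "x \<oplus>\<^bsub>E\<^esub> y \<in> torsion n" if "x \<in> torsion n" "y \<in> torsion n" for x y
    using that mp by (simp add: torsion_def E.smult_r_distr)
  show "r \<odot>\<^bsub>E\<^esub> x \<in> torsion n" if "r \<in> carrier R" "x \<in> torsion n" for r x
    using that mp by (simp add: torsion_def E.smult_comm[of _ r])
qed

lemma torsion_incseq: "n \<le> k \<Longrightarrow> torsion n \<subseteq> torsion k"
  using max_power_decseq[of n k] by (auto simp: torsion_def)

lemma torsion_Suc_iff:
  assumes x: "x \<in> carrier E"
  shows "x \<in> torsion (Suc n) \<longleftrightarrow> (\<forall>r\<in>\<mm>. r \<odot>\<^bsub>E\<^esub> x \<in> torsion n)"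
proof
  have mp: "a \<in> carrier R" if "a \<in> max_power n" for n a using max_power_subset that by blast
  have m: "r \<in> carrier R" if "r \<in> \<mm>" for r using that ideal.Icarr[OF max_ideal] by blast
  show "\<forall>r\<in>\<mm>. r \<odot>\<^bsub>E\<^esub> x \<in> torsion n" if xs: "x \<in> torsion (Suc n)"
  proof
    fix r assume r: "r \<in> \<mm>"
    have "a \<odot>\<^bsub>E\<^esub> (r \<odot>\<^bsub>E\<^esub> x) = \<zero>\<^bsub>E\<^esub>" if a: "a \<in> max_power n" for a
    proof -
      have "a \<otimes> r \<in> max_power (Suc n)" unfolding max_power_Suc using a r by (rule ideal_prod.prod)
      then show ?thesis using torsionD[OF xs] mp[OF a] m[OF r] x by (simp add: E.smult_assoc1[symmetric])
    qed
    then show "r \<odot>\<^bsub>E\<^esub> x \<in> torsion n" using m[OF r] x by (simp add: torsion_def)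
  qed
  show "x \<in> torsion (Suc n)" if rx: "\<forall>r\<in>\<mm>. r \<odot>\<^bsub>E\<^esub> x \<in> torsion n"
  proof -
    have "a \<in> carrier R \<and> a \<odot>\<^bsub>E\<^esub> x = \<zero>\<^bsub>E\<^esub>" if "a \<in> max_power n \<cdot> \<mm>" for a
      using that
    proof (induction a rule: ideal_prod.induct)
      case (prod a r)
      then have "a \<odot>\<^bsub>E\<^esub> (r \<odot>\<^bsub>E\<^esub> x) = \<zero>\<^bsub>E\<^esub>" using rx torsionD by blast
      then show ?case using mp[OF prod(1)] m[OF prod(2)] x by (simp add: E.smult_assoc1)
    next
      case (sum a b)
      then show ?case using x by (simp add: E.smult_l_distr)
    qed
    then show ?thesis using x unfolding torsion_def max_power_Suc by blast
  qed
qed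

text \<open>
  Among the elements that are not \<open>\<mm>\<close>-power torsion choose \<open>x\<close> with maximal annihilator.  For
  \<open>r \<in> \<mm>\<close> the annihilator of \<open>r x\<close> is strictly larger: a multiple \<open>s x = e\<close> exists, and \<open>r s x = 0\<close>.
  So every \<open>r x\<close> is torsion, with a common exponent because the ascending ideals of all \<open>r\<close> with
  \<open>r x \<in> torsion n\<close> stabilize, and then so is \<open>x\<close>.
\<close>

lemma every_element_torsion:
  assumes "x \<in> carrier E" shows "\<exists>n. x \<in> torsion n"
proof (rule ccontr)
  assume nt: "\<nexists>n. x \<in> torsion n"
  define ann where "ann y = {r \<in> carrier R. r \<odot>\<^bsub>E\<^esub> y = \<zero>\<^bsub>E\<^esub>}" for y
  define NT where "NT = {y \<in> carrier E. \<forall>n. y \<notin> torsion n}"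
  have annI: "ideal (ann y) R" if "y \<in> carrier E" for y
    using E.colon_element_ideal[OF E.zero_submodule that] by (simp add: ann_def)
  have "\<exists>I\<in>ann ` NT. \<forall>J\<in>ann ` NT. I \<subseteq> J \<longrightarrow> J = I"
  proof (rule exists_maximal_ideal_in_family)
    show "ann ` NT \<noteq> {}" using assms nt by (auto simp: NT_def)
    show "ideal I R" if "I \<in> ann ` NT" for I using that annI by (auto simp: NT_def)
  qed
  then obtain y where yNT: "y \<in> NT" and max: "\<And>z. z \<in> NT \<Longrightarrow> ann y \<subseteq> ann z \<Longrightarrow> ann z = ann y"
    by auto
  have y: "y \<in> carrier E" and yt: "\<And>n. y \<notin> torsion n" using yNT by (auto simp: NT_def)
  have "y \<noteq> \<zero>\<^bsub>E\<^esub>" using yt[of 0] E.submodule_zero[OF submodule_torsion] by metis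
  then obtain s where s: "s \<in> carrier R" "s \<odot>\<^bsub>E\<^esub> y = e" using essential y by blast
  have m: "r \<in> carrier R" if "r \<in> \<mm>" for r using that ideal.Icarr[OF max_ideal] by blast
  have ry: "\<exists>n. r \<odot>\<^bsub>E\<^esub> y \<in> torsion n" if r: "r \<in> \<mm>" for r
  proof (rule ccontr)
    assume "\<nexists>n. r \<odot>\<^bsub>E\<^esub> y \<in> torsion n"
    then have "r \<odot>\<^bsub>E\<^esub> y \<in> NT" using y m[OF r] by (simp add: NT_def)
    moreover have "ann y \<subseteq> ann (r \<odot>\<^bsub>E\<^esub> y)"
      using y m[OF r] by (auto simp: ann_def E.smult_comm[of _ r])
    ultimately have "ann (r \<odot>\<^bsub>E\<^esub> y) = ann y" by (rule max)
    moreover have "s \<in> ann (r \<odot>\<^bsub>E\<^esub> y)"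
      using s m[OF r] y max_smult_e[OF r] by (simp add: ann_def E.smult_comm[of s r])
    ultimately have "s \<in> ann y" by simp
    then show False using s e_nonzero by (simp add: ann_def)
  qed
  define J where "J n = {r \<in> carrier R. r \<odot>\<^bsub>E\<^esub> y \<in> torsion n}" for n
  have "\<exists>N. \<forall>n. J n \<subseteq> J N"
  proof (rule ascending_ideals_stabilize)
    show "ideal (J n) R" for n unfolding J_def by (rule E.colon_element_ideal[OF submodule_torsion y])
    show "J n \<subseteq> J (Suc n)" for n using torsion_incseq[of n "Suc n"] by (auto simp: J_def)
  qed
  then obtain N where N: "\<And>n. J n \<subseteq> J N" by blast
  have "r \<odot>\<^bsub>E\<^esub> y \<in> torsion N" if r: "r \<in> \<mm>" for r
  proof -
    obtain n where "r \<odot>\<^bsub>E\<^esub> y \<in> torsion n" using ry[OF r] by blast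
    then have "r \<in> J n" using m[OF r] by (simp add: J_def)
    then have "r \<in> J N" using N by blast
    then show ?thesis by (simp add: J_def)
  qed
  then have "y \<in> torsion (Suc N)" using torsion_Suc_iff[OF y] by blast
  then show False using yt by blast
qed

lemma socle_multiple:
  assumes x: "x \<in> carrier E" and soc: "\<And>r. r \<in> \<mm> \<Longrightarrow> r \<odot>\<^bsub>E\<^esub> x = \<zero>\<^bsub>E\<^esub>"
  shows "\<exists>t\<in>carrier R. x = t \<odot>\<^bsub>E\<^esub> e"
proof (cases "x = \<zero>\<^bsub>E\<^esub>")
  case True
  then show ?thesis using e_closed by (intro bexI[of _ \<zero>]) auto
next
  case False
  then obtain s where s: "s \<in> carrier R" "s \<odot>\<^bsub>E\<^esub> x = e" using essential x by blast
  then have "s \<notin> \<mm>" using soc e_nonzero by auto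
  then obtain t where t: "t \<in> carrier R" "t \<otimes> s = \<one>" using unit_if_not_in_max s by blast
  have "t \<odot>\<^bsub>E\<^esub> e = (t \<otimes> s) \<odot>\<^bsub>E\<^esub> x" using t(1) s x by (simp add: E.smult_assoc1)
  then show ?thesis using t x by (intro bexI[of _ t]) simp_all
qed

lemma identity_hom: "(\<lambda>x\<in>carrier E. x) \<in> module_hom R E E"
  by (rule module_homI) auto

text \<open>
  Multiplication by \<open>a \<in> \<mm>\<^sup>n\<close> maps \<open>torsion (Suc n)\<close> into the simple socle, so on any submodule
  \<open>S\<close> of it either \<open>a\<close> vanishes or some \<open>x\<^sub>0 \<in> S\<close> has \<open>a x\<^sub>0 = e\<close>.  A map \<open>\<theta>\<close> that vanishes
  where \<open>a\<close> does sends \<open>x\<^sub>0\<close> into the socle, to \<open>c e\<close> say, and then \<open>\<theta> = c a\<close> on \<open>S\<close>.  Subtracting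
  \<open>c a\<close> removes \<open>a\<close> from the finite set \<open>T\<close>.
\<close>

lemma endomorphism_step:
  assumes "finite T" and "T \<subseteq> max_power n" and "\<theta> \<in> module_hom R E E"
    and "\<And>x. x \<in> torsion (Suc n) \<Longrightarrow> (\<And>a. a \<in> T \<Longrightarrow> a \<odot>\<^bsub>E\<^esub> x = \<zero>\<^bsub>E\<^esub>) \<Longrightarrow> \<theta> x = \<zero>\<^bsub>E\<^esub>"
  shows "\<exists>s\<in>max_power n. \<forall>x\<in>torsion (Suc n). \<theta> x = s \<odot>\<^bsub>E\<^esub> x"
  using assms
proof (induction T arbitrary: \<theta> rule: finite_induct)
  case empty
  have "\<zero> \<in> max_power n"
    using max_power_ideal by (simp add: additive_subgroup.zero_closed ideal.axioms(1))
  moreover have "\<theta> x = \<zero> \<odot>\<^bsub>E\<^esub> x" if "x \<in> torsion (Suc n)" for x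
    using empty(3)[OF that] torsion_closed[OF that] by simp
  ultimately show ?case by blast
next
  case (insert a T)
  have a: "a \<in> max_power n" and T: "T \<subseteq> max_power n" using insert.prems(1) by auto
  have aR: "a \<in> carrier R" using a max_power_subset by blast
  note \<theta> = insert.prems(2)
  define S where "S = {x \<in> torsion (Suc n). \<forall>b\<in>T. b \<odot>\<^bsub>E\<^esub> x = \<zero>\<^bsub>E\<^esub>}"
  have SE: "x \<in> carrier E" if "x \<in> S" for x using that torsion_closed by (auto simp: S_def)
  have TR: "b \<in> carrier R" if "b \<in> T" for b using T max_power_subset that by blast
  have mR: "r \<in> carrier R" if "r \<in> \<mm>" for r using that ideal.Icarr[OF max_ideal] by blast
  note tors = E.submoduleE[OF submodule_torsion]
  have Ssm: "r \<odot>\<^bsub>E\<^esub> x \<in> S" if "r \<in> carrier R" "x \<in> S" for r x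
    using that TR tors(4)[of r x] SE[OF that(2)] by (auto simp: S_def E.smult_comm[of _ r])
  have Sdiff: "x \<ominus>\<^bsub>E\<^esub> y \<in> S" if "x \<in> S" "y \<in> S" for x y
  proof -
    have "b \<odot>\<^bsub>E\<^esub> (x \<ominus>\<^bsub>E\<^esub> y) = \<zero>\<^bsub>E\<^esub>" if "b \<in> T" for b
      using E.smult_diff_right[OF TR[OF that] SE SE, of x y] \<open>x \<in> S\<close> \<open>y \<in> S\<close> that
      by (simp add: S_def E.M.minus_eq)
    then show ?thesis using that E.submodule_diff[OF submodule_torsion] by (simp add: S_def)
  qed
  have van: "\<theta> x = \<zero>\<^bsub>E\<^esub>" if "x \<in> S" "a \<odot>\<^bsub>E\<^esub> x = \<zero>\<^bsub>E\<^esub>" for x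
    using insert.prems(3)[of x] that by (auto simp: S_def)
  have soc: "r \<odot>\<^bsub>E\<^esub> (a \<odot>\<^bsub>E\<^esub> x) = \<zero>\<^bsub>E\<^esub>" if r: "r \<in> \<mm>" and x: "x \<in> S" for r x
  proof -
    have "r \<odot>\<^bsub>E\<^esub> x \<in> torsion n"
      using torsion_Suc_iff[OF SE[OF x]] x r by (simp add: S_def)
    then show ?thesis using torsionD[OF _ a] E.smult_comm[OF mR[OF r] aR SE[OF x]] by simp
  qed
  obtain c where c: "c \<in> carrier R" and eq: "\<And>x. x \<in> S \<Longrightarrow> \<theta> x = c \<odot>\<^bsub>E\<^esub> (a \<odot>\<^bsub>E\<^esub> x)"
  proof (cases "\<exists>x\<in>S. a \<odot>\<^bsub>E\<^esub> x \<noteq> \<zero>\<^bsub>E\<^esub>")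
    case False
    show ?thesis
      by (rule that[of \<zero>]) (use False van SE aR in auto)
  next
    case True
    then obtain y where y: "y \<in> S" "a \<odot>\<^bsub>E\<^esub> y \<noteq> \<zero>\<^bsub>E\<^esub>" by blast
    then obtain s where s: "s \<in> carrier R" "s \<odot>\<^bsub>E\<^esub> (a \<odot>\<^bsub>E\<^esub> y) = e"
      using essential[of "a \<odot>\<^bsub>E\<^esub> y"] aR SE by auto
    define x0 where "x0 = s \<odot>\<^bsub>E\<^esub> y"
    have x0: "x0 \<in> S" unfolding x0_def by (rule Ssm[OF s(1) y(1)])
    have ax0: "a \<odot>\<^bsub>E\<^esub> x0 = e" using s aR SE[OF y(1)] by (simp add: x0_def E.smult_comm[of a s])
    have "r \<odot>\<^bsub>E\<^esub> \<theta> x0 = \<zero>\<^bsub>E\<^esub>" if r: "r \<in> \<mm>" for r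
    proof -
      have "\<theta> (r \<odot>\<^bsub>E\<^esub> x0) = \<zero>\<^bsub>E\<^esub>"
      proof (rule van[OF Ssm[OF mR[OF r] x0]])
        show "a \<odot>\<^bsub>E\<^esub> (r \<odot>\<^bsub>E\<^esub> x0) = \<zero>\<^bsub>E\<^esub>"
          using soc[OF r x0] E.smult_comm[OF mR[OF r] aR SE[OF x0]] by simp
      qed
      then show ?thesis using module_hom_smult[OF \<theta> mR[OF r] SE[OF x0]] by simp
    qed
    then obtain c where c: "c \<in> carrier R" "\<theta> x0 = c \<odot>\<^bsub>E\<^esub> e"
      using socle_multiple[OF module_hom_closed[OF \<theta> SE[OF x0]]] by blast
    show ?thesis
    proof (rule that[OF c(1)])
      fix x assume x: "x \<in> S"
      then obtain t where t: "t \<in> carrier R" "a \<odot>\<^bsub>E\<^esub> x = t \<odot>\<^bsub>E\<^esub> e"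
        using socle_multiple[of "a \<odot>\<^bsub>E\<^esub> x"] soc aR SE by blast
      have tx0: "t \<odot>\<^bsub>E\<^esub> x0 \<in> S" by (rule Ssm[OF t(1) x0])
      have "a \<odot>\<^bsub>E\<^esub> (x \<ominus>\<^bsub>E\<^esub> t \<odot>\<^bsub>E\<^esub> x0) = a \<odot>\<^bsub>E\<^esub> x \<ominus>\<^bsub>E\<^esub> t \<odot>\<^bsub>E\<^esub> (a \<odot>\<^bsub>E\<^esub> x0)"
        using E.smult_diff_right[OF aR SE[OF x] SE[OF tx0]] E.smult_comm[OF aR t(1) SE[OF x0]] by simp
      also have "\<dots> = \<zero>\<^bsub>E\<^esub>" using t e_closed by (simp add: ax0 E.M.minus_eq E.M.r_neg)
      finally have "\<theta> (x \<ominus>\<^bsub>E\<^esub> t \<odot>\<^bsub>E\<^esub> x0) = \<zero>\<^bsub>E\<^esub>" by (rule van[OF Sdiff[OF x tx0]])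
      then have "\<theta> x = \<theta> (t \<odot>\<^bsub>E\<^esub> x0)"
        using module_hom_diff[OF module_E module_E \<theta> SE[OF x] SE[OF tx0]]
          E.M.diff_eq_zero_iff[OF module_hom_closed[OF \<theta> SE[OF x]] module_hom_closed[OF \<theta> SE[OF tx0]]]
        by simp
      also have "\<dots> = c \<odot>\<^bsub>E\<^esub> (a \<odot>\<^bsub>E\<^esub> x)"
        using module_hom_smult[OF \<theta> t(1) SE[OF x0]] c t e_closed by (simp add: E.smult_comm[of t c])
      finally show "\<theta> x = c \<odot>\<^bsub>E\<^esub> (a \<odot>\<^bsub>E\<^esub> x)" .
    qed
  qed
  define \<theta>' where "\<theta>' = (\<lambda>x\<in>carrier E. \<theta> x \<ominus>\<^bsub>E\<^esub> (c \<otimes> a) \<odot>\<^bsub>E\<^esub> (\<lambda>x\<in>carrier E. x) x)"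
  have \<theta>'_eq: "\<theta>' x = \<theta> x \<ominus>\<^bsub>E\<^esub> (c \<otimes> a) \<odot>\<^bsub>E\<^esub> x" if "x \<in> carrier E" for x
    using that by (simp add: \<theta>'_def)
  have "\<theta>' \<in> module_hom R E E"
    unfolding \<theta>'_def using c aR by (intro module_hom_diff_smult[OF module_E module_E \<theta> identity_hom]) simp
  moreover have "\<theta>' x = \<zero>\<^bsub>E\<^esub>"
    if x: "x \<in> torsion (Suc n)" "\<And>b. b \<in> T \<Longrightarrow> b \<odot>\<^bsub>E\<^esub> x = \<zero>\<^bsub>E\<^esub>" for x
  proof -
    have xS: "x \<in> S" using x by (simp add: S_def)
    show ?thesis using \<theta>'_eq[OF SE[OF xS]] eq[OF xS] c aR SE[OF xS]
      by (simp add: E.smult_assoc1 E.M.minus_eq E.M.r_neg)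
  qed
  ultimately obtain s where s: "s \<in> max_power n"
    and s_eq: "\<And>x. x \<in> torsion (Suc n) \<Longrightarrow> \<theta>' x = s \<odot>\<^bsub>E\<^esub> x"
    using insert.IH[OF T] by blast
  have sR: "s \<in> carrier R" using s max_power_subset by blast
  show ?case
  proof (intro bexI ballI)
    interpret I: ideal "max_power n" R by (rule max_power_ideal)
    show "s \<oplus> c \<otimes> a \<in> max_power n" using s a c I.I_l_closed I.a_closed by simp
    fix x assume x: "x \<in> torsion (Suc n)"
    note xE = torsion_closed[OF x]
    have "\<theta> x = \<theta>' x \<oplus>\<^bsub>E\<^esub> (c \<otimes> a) \<odot>\<^bsub>E\<^esub> x"
      using \<theta>'_eq[OF xE] module_hom_closed[OF \<theta> xE] xE c aR by (simp add: E.M.diff_add_cancel)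
    then show "\<theta> x = (s \<oplus> c \<otimes> a) \<odot>\<^bsub>E\<^esub> x"
      using s_eq[OF x] sR c aR xE by (simp add: E.smult_l_distr)
  qed
qed

text \<open>
  The multipliers found on the successive torsion submodules differ by elements of \<open>\<mm>\<^sup>n\<close>, so they
  form a Cauchy sequence.  Completeness provides the limit, and \<open>E\<close> is the union of the torsion
  submodules.
\<close>

theorem endomorphism_is_multiplication:
  assumes \<phi>: "\<phi> \<in> module_hom R E E"
  shows "\<exists>r\<in>carrier R. \<forall>x\<in>carrier E. \<phi> x = r \<odot>\<^bsub>E\<^esub> x"
proof -
  define good where "good n r \<longleftrightarrow> r \<in> carrier R \<and> (\<forall>x\<in>torsion n. \<phi> x = r \<odot>\<^bsub>E\<^esub> x)" for n r
  have base: "good 0 \<zero>"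
  proof -
    have "\<phi> x = \<zero> \<odot>\<^bsub>E\<^esub> x" if x: "x \<in> torsion 0" for x
    proof -
      have "\<one> \<in> max_power 0" unfolding max_power_0 by (rule one_closed)
      from torsionD[OF x this] have "x = \<zero>\<^bsub>E\<^esub>" using torsion_closed[OF x] by simp
      then show ?thesis using module_hom_zero[OF module_E module_E \<phi>] by simp
    qed
    then show ?thesis by (simp add: good_def)
  qed
  have step: "\<exists>s. good (Suc n) s \<and> s \<ominus> r \<in> max_power n" if r: "good n r" for n r
  proof -
    have rR: "r \<in> carrier R" using r by (simp add: good_def)
    define \<theta> where "\<theta> = (\<lambda>x\<in>carrier E. \<phi> x \<ominus>\<^bsub>E\<^esub> r \<odot>\<^bsub>E\<^esub> (\<lambda>x\<in>carrier E. x) x)"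
    have \<theta>_eq: "\<theta> x = \<phi> x \<ominus>\<^bsub>E\<^esub> r \<odot>\<^bsub>E\<^esub> x" if "x \<in> carrier E" for x
      using that by (simp add: \<theta>_def)
    have \<theta>: "\<theta> \<in> module_hom R E E"
      unfolding \<theta>_def by (rule module_hom_diff_smult[OF module_E module_E \<phi> identity_hom rR])
    obtain T where T: "T \<subseteq> carrier R" "finite T" "max_power n = Idl T"
      using finetely_gen[OF max_power_ideal] by blast
    have van: "\<theta> x = \<zero>\<^bsub>E\<^esub>"
      if x: "x \<in> torsion (Suc n)" and "\<And>a. a \<in> T \<Longrightarrow> a \<odot>\<^bsub>E\<^esub> x = \<zero>\<^bsub>E\<^esub>" for x
    proof -
      note xE = torsion_closed[OF x]
      have "T \<subseteq> {a \<in> carrier R. a \<odot>\<^bsub>E\<^esub> x \<in> {\<zero>\<^bsub>E\<^esub>}}" using T(1) that(2) by auto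
      then have "max_power n \<subseteq> {a \<in> carrier R. a \<odot>\<^bsub>E\<^esub> x \<in> {\<zero>\<^bsub>E\<^esub>}}"
        unfolding T(3) by (rule genideal_minimal[OF E.colon_element_ideal[OF E.zero_submodule xE]])
      then have "x \<in> torsion n" using xE by (auto simp: torsion_def)
      then show ?thesis using r xE rR by (simp add: \<theta>_eq good_def E.M.minus_eq E.M.r_neg)
    qed
    have "T \<subseteq> max_power n" unfolding T(3) by (rule genideal_self[OF T(1)])
    from endomorphism_step[OF T(2) this \<theta> van]
    obtain s where s: "s \<in> max_power n" "\<And>x. x \<in> torsion (Suc n) \<Longrightarrow> \<theta> x = s \<odot>\<^bsub>E\<^esub> x" by blast
    have sR: "s \<in> carrier R" using s(1) max_power_subset by blast
    have "\<phi> x = (s \<oplus> r) \<odot>\<^bsub>E\<^esub> x" if x: "x \<in> torsion (Suc n)" for x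
    proof -
      note xE = torsion_closed[OF x]
      have "\<phi> x = \<theta> x \<oplus>\<^bsub>E\<^esub> r \<odot>\<^bsub>E\<^esub> x"
        using \<theta>_eq[OF xE] module_hom_closed[OF \<phi> xE] xE rR by (simp add: E.M.diff_add_cancel)
      then show ?thesis using s(2)[OF x] sR rR xE by (simp add: E.smult_l_distr)
    qed
    then have "good (Suc n) (s \<oplus> r)" using sR rR by (simp add: good_def)
    moreover have "(s \<oplus> r) \<ominus> r = s" using sR rR by (simp add: a_minus_def a_assoc r_neg)
    ultimately show ?thesis using s(1) by metis
  qed
  obtain \<rho> where \<rho>: "\<And>n. good n (\<rho> n)" "\<And>n. \<rho> (Suc n) \<ominus> \<rho> n \<in> max_power n"
  proof -
    have "\<exists>\<rho>. \<forall>n. good n (\<rho> n) \<and> \<rho> (Suc n) \<ominus> \<rho> n \<in> max_power n"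
      by (rule dependent_nat_choice) (use base step in auto)
    then show ?thesis using that by blast
  qed
  have \<rho>R: "\<rho> n \<in> carrier R" for n using \<rho>(1)[of n] by (simp add: good_def)
  have tail: "\<rho> p \<ominus> \<rho> n \<in> max_power n" if "n \<le> p" for n p
    using that
  proof (induction p rule: dec_induct)
    case base
    have "\<zero> \<in> max_power n"
      using max_power_ideal by (simp add: additive_subgroup.zero_closed ideal.axioms(1))
    then show ?case using \<rho>R by (simp add: a_minus_def r_neg)
  next
    case (step p)
    interpret I: ideal "max_power n" R by (rule max_power_ideal)
    have "\<rho> (Suc p) \<ominus> \<rho> p \<in> max_power n" using \<rho>(2)[of p] max_power_decseq[OF step(1)] by blast
    then have "(\<rho> (Suc p) \<ominus> \<rho> p) \<oplus> (\<rho> p \<ominus> \<rho> n) \<in> max_power n" using step(3) by (rule I.a_closed)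
    also have "(\<rho> (Suc p) \<ominus> \<rho> p) \<oplus> (\<rho> p \<ominus> \<rho> n) = \<rho> (Suc p) \<ominus> \<rho> n"
      using \<rho>R by (simp add: a_minus_def a_assoc r_neg1)
    finally show ?case .
  qed
  have "\<exists>K. \<forall>p\<ge>K. \<forall>q\<ge>K. \<rho> p \<ominus> \<rho> q \<in> max_power n" for n
  proof (intro exI allI impI)
    fix p q assume "n \<le> p" "n \<le> q"
    then have "(\<rho> p \<ominus> \<rho> n) \<ominus> (\<rho> q \<ominus> \<rho> n) \<in> max_power n"
      by (intro ideal_diff[OF max_power_ideal] tail)
    also have "(\<rho> p \<ominus> \<rho> n) \<ominus> (\<rho> q \<ominus> \<rho> n) = \<rho> p \<ominus> \<rho> q"
      using \<rho>R by (simp add: a_minus_def minus_add a_ac r_neg1 r_neg2)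
    finally show "\<rho> p \<ominus> \<rho> q \<in> max_power n" .
  qed
  then obtain r where r: "r \<in> carrier R" "\<And>n. \<exists>K. \<forall>p\<ge>K. \<rho> p \<ominus> r \<in> max_power n"
    using Cauchy_convergent[of \<rho>] \<rho>R by blast
  have "\<phi> x = r \<odot>\<^bsub>E\<^esub> x" if x: "x \<in> carrier E" for x
  proof -
    obtain n where n: "x \<in> torsion n" using every_element_torsion[OF x] by blast
    obtain K where K: "\<And>p. p \<ge> K \<Longrightarrow> \<rho> p \<ominus> r \<in> max_power n" using r(2) by blast
    define p where "p = max n K"
    have "x \<in> torsion p" using n torsion_incseq[of n p] by (auto simp: p_def)
    then have "\<phi> x = \<rho> p \<odot>\<^bsub>E\<^esub> x" using \<rho>(1)[of p] by (simp add: good_def)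
    moreover have "(\<rho> p \<ominus> r) \<odot>\<^bsub>E\<^esub> x = \<zero>\<^bsub>E\<^esub>" by (rule torsionD[OF n K]) (simp add: p_def)
    ultimately show ?thesis
      using \<rho>R[of p] r(1) x by (simp add: E.smult_diff_left E.M.diff_eq_zero_iff)
  qed
  then show ?thesis using r(1) by blast
qed

end


section \<open>Matlis duality for Artinian modules\<close>

lemma artinian_minimal_submodule:
  assumes art: "artinian_module R M" and ne: "F \<noteq> {}" and F: "\<And>S. S \<in> F \<Longrightarrow> submodule S R M"
  shows "\<exists>S\<in>F. \<forall>T\<in>F. T \<subseteq> S \<longrightarrow> T = S"
proof (rule ccontr)
  assume "\<not> ?thesis"
  then have "\<exists>T. T \<in> F \<and> T \<subset> S" if "S \<in> F" for S using that by blast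
  moreover have "\<exists>S. S \<in> F" using ne by blast
  ultimately have "\<exists>S. \<forall>n::nat. S n \<in> F \<and> S (Suc n) \<subset> S n"
    by (intro dependent_nat_choice) auto
  then obtain S where S: "\<And>n::nat. S n \<in> F" "\<And>n. S (Suc n) \<subset> S n" by blast
  then have "\<exists>n. \<forall>k\<ge>n. S k = S n"
    using art F unfolding artinian_module_def by (metis psubset_imp_subset)
  then obtain n where "S (Suc n) = S n" by (meson le_Suc_eq order_refl)
  then show False using S(2)[of n] by simp
qed

text \<open>A minimal common kernel of finitely many functionals in \<open>L\<close> exists by the descending chain
  condition; enlarging the finite set cannot make it smaller.\<close>

lemma artinian_common_kernel_finite:
  assumes art: "artinian_module R M" and E: "module R E" and L: "L \<subseteq> module_hom R M E"
  shows "\<exists>F\<subseteq>L. finite F \<and> common_kernel E M F = common_kernel E M L"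
proof -
  have M: "module R M" using art by (simp add: artinian_module_def)
  have "\<exists>S\<in>common_kernel E M ` {F. finite F \<and> F \<subseteq> L}.
      \<forall>T\<in>common_kernel E M ` {F. finite F \<and> F \<subseteq> L}. T \<subseteq> S \<longrightarrow> T = S"
  proof (rule artinian_minimal_submodule[OF art])
    show "common_kernel E M ` {F. finite F \<and> F \<subseteq> L} \<noteq> {}" by blast
    fix S assume "S \<in> common_kernel E M ` {F. finite F \<and> F \<subseteq> L}"
    then obtain F where "F \<subseteq> L" "S = common_kernel E M F" by blast
    then show "submodule S R M" using submodule_common_kernel[OF M E] L by blast
  qed
  then obtain F where F: "finite F" "F \<subseteq> L"
    and min: "\<And>G. finite G \<Longrightarrow> G \<subseteq> L \<Longrightarrow> common_kernel E M G \<subseteq> common_kernel E M F \<Longrightarrow>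
      common_kernel E M G = common_kernel E M F" by auto
  have "f x = \<zero>\<^bsub>E\<^esub>" if f: "f \<in> L" and x: "x \<in> common_kernel E M F" for f x
  proof -
    have "common_kernel E M (insert f F) = common_kernel E M F"
      using F f by (intro min) (auto simp: common_kernel_def)
    then have "x \<in> common_kernel E M (insert f F)" using x by simp
    then show ?thesis by (simp add: common_kernel_def)
  qed
  then have "common_kernel E M F = common_kernel E M L"
    using F(2) by (auto simp: common_kernel_def)
  then show ?thesis using F by blast
qed

context residue_hull
begin

interpretation E: module R E by (rule module_E)

lemma module_dual: "module R M \<Longrightarrow> module R (matlis_dual R E M)"
  by (rule module_hom_module[OF _ module_E])

lemma common_kernel_annihilator:
  fixes M :: "('a, 'm) module"
  assumes M: "module R M" and N: "submodule N R M"
  shows "common_kernel E M (annihilator R E M N) = N"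
proof
  show "N \<subseteq> common_kernel E M (annihilator R E M N)"
    using module.submoduleE(1)[OF M N] by (auto simp: common_kernel_def annihilator_def)
  show "common_kernel E M (annihilator R E M N) \<subseteq> N"
  proof
    fix x assume x: "x \<in> common_kernel E M (annihilator R E M N)"
    show "x \<in> N"
    proof (rule ccontr)
      assume nx: "x \<notin> N"
      have "x \<in> carrier M" using x by (simp add: common_kernel_def)
      then obtain f where "f \<in> module_hom R M E" "\<forall>y\<in>N. f y = \<zero>\<^bsub>E\<^esub>" "f x \<noteq> \<zero>\<^bsub>E\<^esub>"
        using cogenerator[OF M N _ nx] by blast
      then show False using x by (simp add: common_kernel_def annihilator_def)
    qed
  qed
qed

text \<open>On \<open>S\<close> the map \<open>f\<close> factors through \<open>g\<close>.  The factor, defined on \<open>g S \<subseteq> E\<close>, extends to an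
  endomorphism of \<open>E\<close>, which is a multiplication.\<close>

lemma functional_multiple:
  fixes M :: "('a, 'm) module"
  assumes M: "module R M" and S: "submodule S R M"
    and f: "f \<in> module_hom R M E" and g: "g \<in> module_hom R M E"
    and ker: "\<And>x. x \<in> S \<Longrightarrow> g x = \<zero>\<^bsub>E\<^esub> \<Longrightarrow> f x = \<zero>\<^bsub>E\<^esub>"
  shows "\<exists>r\<in>carrier R. \<forall>x\<in>S. f x = r \<odot>\<^bsub>E\<^esub> g x"
proof -
  interpret M: module R M by fact
  note S' = M.submoduleE[OF S]
  have SM: "x \<in> carrier M" if "x \<in> S" for x using S'(1) that by blast
  define h where "h = (\<lambda>y\<in>g ` S. f (SOME x. x \<in> S \<and> g x = y))"
  have h: "h (g x) = f x" if x: "x \<in> S" for x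
  proof -
    define z where "z = (SOME z. z \<in> S \<and> g z = g x)"
    have z: "z \<in> S \<and> g z = g x" unfolding z_def by (rule someI[of _ x]) (use x in simp)
    have zM: "z \<in> carrier M" and xM: "x \<in> carrier M" using z x SM by simp_all
    have "g (z \<ominus>\<^bsub>M\<^esub> x) = \<zero>\<^bsub>E\<^esub>"
      using module_hom_diff[OF M module_E g zM xM] z module_hom_closed[OF g xM]
      by (simp add: E.M.minus_eq E.M.r_neg)
    then have "f (z \<ominus>\<^bsub>M\<^esub> x) = \<zero>\<^bsub>E\<^esub>" using ker M.submodule_diff[OF S _ x] z by blast
    then have "f z = f x"
      using module_hom_diff[OF M module_E f zM xM]
        E.M.diff_eq_zero_iff[OF module_hom_closed[OF f zM] module_hom_closed[OF f xM]] by simp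
    then show ?thesis using x by (simp add: h_def z_def)
  qed
  have gS: "submodule (g ` S) R E" by (rule submodule_image[OF M module_E g S])
  have "h \<in> module_hom R (E\<lparr>carrier := g ` S\<rparr>) E"
  proof (rule module_homI)
    show "h \<in> carrier (E\<lparr>carrier := g ` S\<rparr>) \<rightarrow>\<^sub>E carrier E"
    proof (rule PiE_I)
      fix y assume "y \<in> carrier (E\<lparr>carrier := g ` S\<rparr>)"
      then obtain x where "x \<in> S" "y = g x" by auto
      then show "h y \<in> carrier E" using h module_hom_closed[OF f SM] by simp
    qed (simp add: h_def)
    fix y assume "y \<in> carrier (E\<lparr>carrier := g ` S\<rparr>)"
    then obtain x where x: "x \<in> S" "y = g x" by auto
    show "h (r \<odot>\<^bsub>E\<lparr>carrier := g ` S\<rparr>\<^esub> y) = r \<odot>\<^bsub>E\<^esub> h y" if r: "r \<in> carrier R" for r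
      using h[OF S'(4)[OF r x(1)]] h[OF x(1)] x(2) module_hom_smult[OF g r SM[OF x(1)]]
        module_hom_smult[OF f r SM[OF x(1)]] by simp
    fix z assume "z \<in> carrier (E\<lparr>carrier := g ` S\<rparr>)"
    then obtain w where w: "w \<in> S" "z = g w" by auto
    show "h (y \<oplus>\<^bsub>E\<lparr>carrier := g ` S\<rparr>\<^esub> z) = h y \<oplus>\<^bsub>E\<^esub> h z"
      using h[OF S'(5)[OF x(1) w(1)]] h[OF x(1)] h[OF w(1)] x(2) w(2)
        module_hom_add[OF g SM[OF x(1)] SM[OF w(1)]] module_hom_add[OF f SM[OF x(1)] SM[OF w(1)]]
      by simp
  qed
  then obtain \<phi> where \<phi>: "\<phi> \<in> module_hom R E E" "\<And>y. y \<in> g ` S \<Longrightarrow> \<phi> y = h y"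
    using injective_module_extend[OF inj module_E gS] by blast
  obtain r where r: "r \<in> carrier R" "\<And>y. y \<in> carrier E \<Longrightarrow> \<phi> y = r \<odot>\<^bsub>E\<^esub> y"
    using endomorphism_is_multiplication[OF \<phi>(1)] by blast
  have "f x = r \<odot>\<^bsub>E\<^esub> g x" if x: "x \<in> S" for x
    using h[OF x] \<phi>(2)[of "g x"] r(2)[OF module_hom_closed[OF g SM[OF x]]] x by simp
  then show ?thesis using r(1) by blast
qed

text \<open>By induction on \<open>F\<close>: on the common kernel of the remaining functionals \<open>f\<close> is a multiple \<open>r g\<close>
  of the one that is removed, and \<open>f - r g\<close> falls under the induction hypothesis.  Stating the
  conclusion for every submodule \<open>L\<close> that contains \<open>F\<close> avoids linear combinations.\<close>

lemma finite_double_annihilator: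
  fixes M :: "('a, 'm) module"
  assumes M: "module R M" and L: "submodule L R (matlis_dual R E M)"
    and "finite F" and "F \<subseteq> L" and "f \<in> module_hom R M E"
    and "\<And>x. x \<in> common_kernel E M F \<Longrightarrow> f x = \<zero>\<^bsub>E\<^esub>"
  shows "f \<in> L"
  using assms(3-)
proof (induction F arbitrary: f rule: finite_induct)
  case empty
  interpret D: module R "matlis_dual R E M" by (rule module_dual[OF M])
  have "f = \<zero>\<^bsub>matlis_dual R E M\<^esub>"
    using empty.prems D.M.zero_closed
    by (intro module_hom_eqI[of f R M E]) (auto simp: common_kernel_def)
  then show ?case using D.submodule_zero[OF L] by (simp only:)
next
  case (insert g F)
  interpret D: module R "matlis_dual R E M" by (rule module_dual[OF M])
  note L' = D.submoduleE[OF L]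
  have g: "g \<in> module_hom R M E" "g \<in> L" and F: "F \<subseteq> L" "F \<subseteq> module_hom R M E"
    using insert.prems(1) L'(1) by auto
  note f = insert.prems(2)
  have "\<exists>r\<in>carrier R. \<forall>x\<in>common_kernel E M F. f x = r \<odot>\<^bsub>E\<^esub> g x"
    by (rule functional_multiple[OF M submodule_common_kernel[OF M module_E F(2)] f g(1)])
      (rule insert.prems(3), simp add: common_kernel_def)
  then obtain r where r: "r \<in> carrier R" "\<And>x. x \<in> common_kernel E M F \<Longrightarrow> f x = r \<odot>\<^bsub>E\<^esub> g x"
    by blast
  define f' where "f' = (\<lambda>x\<in>carrier M. f x \<ominus>\<^bsub>E\<^esub> r \<odot>\<^bsub>E\<^esub> g x)"
  have f': "f' \<in> module_hom R M E"
    unfolding f'_def by (rule module_hom_diff_smult[OF M module_E f g(1) r(1)])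
  have "f' x = \<zero>\<^bsub>E\<^esub>" if x: "x \<in> common_kernel E M F" for x
  proof -
    have "x \<in> carrier M" using x by (simp add: common_kernel_def)
    then show ?thesis using r(1) r(2)[OF x] module_hom_closed[OF g(1)]
      by (simp add: f'_def E.M.minus_eq E.M.r_neg)
  qed
  then have f'L: "f' \<in> L" by (rule insert.IH[OF F(1) f'])
  have "f = f' \<oplus>\<^bsub>matlis_dual R E M\<^esub> (r \<odot>\<^bsub>matlis_dual R E M\<^esub> g)"
  proof (rule module_hom_eqI[OF f])
    show "f' \<oplus>\<^bsub>matlis_dual R E M\<^esub> (r \<odot>\<^bsub>matlis_dual R E M\<^esub> g) \<in> module_hom R M E"
      using D.M.add.m_closed[of f' "r \<odot>\<^bsub>matlis_dual R E M\<^esub> g"] D.smult_closed[OF r(1), of g] f' g(1)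
      by (simp del: hom_module_simps(2-))
    show "f x = (f' \<oplus>\<^bsub>matlis_dual R E M\<^esub> (r \<odot>\<^bsub>matlis_dual R E M\<^esub> g)) x" if x: "x \<in> carrier M" for x
      using x module_hom_closed[OF f x] module_hom_closed[OF g(1) x] r(1)
      by (simp add: f'_def E.M.diff_add_cancel)
  qed
  then show ?case using L'(5)[OF f'L L'(4)[OF r(1) g(2)]] by (simp only:)
qed

theorem annihilator_common_kernel:
  fixes M :: "('a, 'm) module"
  assumes art: "artinian_module R M" and L: "submodule L R (matlis_dual R E M)"
  shows "annihilator R E M (common_kernel E M L) = L"
proof -
  have M: "module R M" using art by (simp add: artinian_module_def)
  have LM: "L \<subseteq> module_hom R M E" using module.submoduleE(1)[OF module_dual[OF M] L] by simp
  obtain F where F: "F \<subseteq> L" "finite F" "common_kernel E M F = common_kernel E M L"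
    using artinian_common_kernel_finite[OF art module_E LM] by blast
  have "f \<in> L" if "f \<in> annihilator R E M (common_kernel E M L)" for f
    by (rule finite_double_annihilator[OF M L F(2,1)]) (use that F(3) in \<open>auto simp: annihilator_def\<close>)
  moreover have "L \<subseteq> annihilator R E M (common_kernel E M L)"
    using LM by (auto simp: annihilator_def common_kernel_def)
  ultimately show ?thesis by blast
qed

lemma evaluation_hom:
  fixes M :: "('a, 'm) module"
  assumes M: "module R M" and x: "x \<in> carrier M"
  shows "biduality R E M x \<in> module_hom R (matlis_dual R E M) E"
proof -
  interpret D: module R "matlis_dual R E M" by (rule module_dual[OF M])
  show ?thesis
  proof (rule module_homI)
    show "biduality R E M x \<in> carrier (matlis_dual R E M) \<rightarrow>\<^sub>E carrier E"
    proof (rule PiE_I)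
      show "biduality R E M x f \<in> carrier E" if "f \<in> carrier (matlis_dual R E M)" for f
        using module_hom_closed[of f R M E x] that x by (simp add: biduality_def)
    qed (use x in \<open>simp add: biduality_def\<close>)
    show "biduality R E M x (f \<oplus>\<^bsub>matlis_dual R E M\<^esub> g) =
        biduality R E M x f \<oplus>\<^bsub>E\<^esub> biduality R E M x g"
      if "f \<in> carrier (matlis_dual R E M)" "g \<in> carrier (matlis_dual R E M)" for f g
      using D.M.add.m_closed[OF that] that x by (simp add: biduality_def)
    show "biduality R E M x (r \<odot>\<^bsub>matlis_dual R E M\<^esub> f) = r \<odot>\<^bsub>E\<^esub> biduality R E M x f"
      if "r \<in> carrier R" "f \<in> carrier (matlis_dual R E M)" for r f
      using D.smult_closed[OF that] that x by (simp add: biduality_def)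
  qed
qed

text \<open>
  Induction on \<open>F\<close>: a solution \<open>b\<^sub>0\<close> for \<open>F\<close> has to be corrected by an element of the common
  kernel \<open>S\<close> of \<open>F\<close> to meet a further condition \<open>g b = \<psi> g\<close>.  If \<open>\<psi> g - g b\<^sub>0\<close> were not in \<open>g S\<close>,
  some scalar \<open>r\<close> would kill \<open>g S\<close> but not this difference.  Then \<open>r g\<close> vanishes on \<open>S\<close>, hence lies
  in every submodule that contains \<open>F\<close>, in particular in the one where \<open>\<psi>\<close> is evaluation at \<open>b\<^sub>0\<close>.
\<close>

lemma finite_evaluation:
  fixes M :: "('a, 'm) module"
  assumes M: "module R M" and \<psi>: "\<psi> \<in> module_hom R (matlis_dual R E M) E"
    and "finite F" and "F \<subseteq> module_hom R M E"
  shows "\<exists>b\<in>carrier M. \<forall>f\<in>F. f b = \<psi> f"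
  using assms(3,4)
proof (induction F rule: finite_induct)
  case empty
  interpret M: module R M by fact
  show ?case by auto
next
  case (insert g F)
  interpret M: module R M by fact
  interpret D: module R "matlis_dual R E M" by (rule module_dual[OF M])
  have g: "g \<in> module_hom R M E" and F: "F \<subseteq> module_hom R M E" using insert.prems by auto
  obtain b0 where b0: "b0 \<in> carrier M" "\<And>f. f \<in> F \<Longrightarrow> f b0 = \<psi> f" using insert.IH[OF F] by blast
  define S where "S = common_kernel E M F"
  have S: "submodule S R M" unfolding S_def by (rule submodule_common_kernel[OF M module_E F])
  have SM: "x \<in> carrier M" if "x \<in> S" for x using that by (simp add: S_def common_kernel_def)
  have gS: "submodule (g ` S) R E" by (rule submodule_image[OF M module_E g S])
  define d where "d = \<psi> g \<ominus>\<^bsub>E\<^esub> g b0"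
  have \<psi>g: "\<psi> g \<in> carrier E" using module_hom_closed[OF \<psi>] g by simp
  have gb0: "g b0 \<in> carrier E" by (rule module_hom_closed[OF g b0(1)])
  have dE: "d \<in> carrier E" using \<psi>g gb0 by (simp add: d_def)
  have "d \<in> g ` S"
  proof (rule ccontr)
    assume "d \<notin> g ` S"
    then obtain p where p: "p \<in> module_hom R E E" "\<And>y. y \<in> g ` S \<Longrightarrow> p y = \<zero>\<^bsub>E\<^esub>" "p d \<noteq> \<zero>\<^bsub>E\<^esub>"
      using cogenerator[OF module_E gS dE] by blast
    obtain r where r: "r \<in> carrier R" "\<And>y. y \<in> carrier E \<Longrightarrow> p y = r \<odot>\<^bsub>E\<^esub> y"
      using endomorphism_is_multiplication[OF p(1)] by blast
    define rg where "rg = r \<odot>\<^bsub>matlis_dual R E M\<^esub> g"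
    have rg: "rg \<in> module_hom R M E" using D.smult_closed[OF r(1), of g] g by (simp add: rg_def)
    have rg_eq: "rg x = r \<odot>\<^bsub>E\<^esub> g x" if "x \<in> carrier M" for x using that by (simp add: rg_def)
    \<comment> \<open>The submodule on which \<open>\<psi>\<close> is evaluation at \<open>b\<^sub>0\<close> is the kernel of the difference; the
      scalar \<open>\<one>\<close> only brings the difference into the form \<open>f - r g\<close>.\<close>
    define eb where "eb = (\<lambda>f\<in>carrier (matlis_dual R E M). \<psi> f \<ominus>\<^bsub>E\<^esub> \<one> \<odot>\<^bsub>E\<^esub> biduality R E M b0 f)"
    have bid: "biduality R E M b0 \<in> module_hom R (matlis_dual R E M) E"
      by (rule evaluation_hom[OF M b0(1)])
    have eb: "eb \<in> module_hom R (matlis_dual R E M) E"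
      unfolding eb_def by (rule module_hom_diff_smult[OF module_dual[OF M] module_E \<psi> bid one_closed])
    have eb_eq: "eb f = \<psi> f \<ominus>\<^bsub>E\<^esub> f b0" if "f \<in> module_hom R M E" for f
      using that b0(1) module_hom_closed[OF that b0(1)] by (simp add: eb_def biduality_def)
    define L where "L = common_kernel E (matlis_dual R E M) {eb}"
    have "rg \<in> L"
    proof (rule finite_double_annihilator[OF M _ insert.hyps(1) _ rg])
      show "submodule L R (matlis_dual R E M)"
        unfolding L_def using eb by (intro submodule_common_kernel[OF module_dual[OF M] module_E]) simp
      show "F \<subseteq> L"
      proof
        fix f assume f: "f \<in> F"
        then have fM: "f \<in> module_hom R M E" using F by blast
        then show "f \<in> L"
          using eb_eq[OF fM] b0(2)[OF f] module_hom_closed[OF fM b0(1)]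
          by (simp add: L_def common_kernel_def E.M.minus_eq E.M.r_neg)
      qed
      fix x assume "x \<in> common_kernel E M F"
      then have x: "x \<in> S" by (simp add: S_def)
      then show "rg x = \<zero>\<^bsub>E\<^esub>"
        using rg_eq[OF SM[OF x]] p(2)[of "g x"] r(2)[OF module_hom_closed[OF g SM[OF x]]] by simp
    qed
    then have "\<psi> rg \<ominus>\<^bsub>E\<^esub> r \<odot>\<^bsub>E\<^esub> g b0 = \<zero>\<^bsub>E\<^esub>"
      using eb_eq[OF rg] rg_eq[OF b0(1)] by (simp add: L_def common_kernel_def)
    moreover have "\<psi> rg = r \<odot>\<^bsub>E\<^esub> \<psi> g"
      unfolding rg_def using module_hom_smult[OF \<psi> r(1), of g] g by (simp del: hom_module_simps(2-))
    ultimately have "r \<odot>\<^bsub>E\<^esub> d = \<zero>\<^bsub>E\<^esub>" using r(1) \<psi>g gb0 by (simp add: d_def E.smult_diff_right)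
    then show False using p(3) r(2)[OF dE] by simp
  qed
  then obtain c where c: "c \<in> S" "d = g c" by blast
  show ?case
  proof (intro bexI[of _ "b0 \<oplus>\<^bsub>M\<^esub> c"] ballI)
    show "b0 \<oplus>\<^bsub>M\<^esub> c \<in> carrier M" using b0(1) SM[OF c(1)] by simp
    fix f assume "f \<in> insert g F"
    then consider "f = g" | "f \<in> F" by blast
    then show "f (b0 \<oplus>\<^bsub>M\<^esub> c) = \<psi> f"
    proof cases
      case 1
      have "g (b0 \<oplus>\<^bsub>M\<^esub> c) = d \<oplus>\<^bsub>E\<^esub> g b0"
        using module_hom_add[OF g b0(1) SM[OF c(1)]] c(2) dE gb0 by (simp add: E.M.a_comm)
      then show ?thesis using 1 \<psi>g gb0 by (simp add: d_def E.M.diff_add_cancel)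
    next
      case 2
      have f: "f \<in> module_hom R M E" using 2 F by blast
      have "f c = \<zero>\<^bsub>E\<^esub>" using c(1) 2 by (simp add: S_def common_kernel_def)
      then show ?thesis
        using module_hom_add[OF f b0(1) SM[OF c(1)]] b0(2)[OF 2] module_hom_closed[OF f b0(1)] by simp
    qed
  qed
qed

lemma biduality_hom:
  fixes M :: "('a, 'm) module"
  assumes M: "module R M"
  shows "biduality R E M \<in> module_hom R M (matlis_dual R E (matlis_dual R E M))"
proof -
  interpret M: module R M by fact
  show ?thesis
  proof (rule module_homI)
    show "biduality R E M \<in> carrier M \<rightarrow>\<^sub>E carrier (matlis_dual R E (matlis_dual R E M))"
    proof (rule PiE_I)
      fix x assume "x \<in> carrier M"
      then show "biduality R E M x \<in> carrier (matlis_dual R E (matlis_dual R E M))"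
        using evaluation_hom[OF M] by simp
    qed (simp add: biduality_def)
  next
    fix x y assume xy: "x \<in> carrier M" "y \<in> carrier M"
    have "f (x \<oplus>\<^bsub>M\<^esub> y) = f x \<oplus>\<^bsub>E\<^esub> f y" if "f \<in> module_hom R M E" for f
      by (rule module_hom_add[OF that xy])
    then show "biduality R E M (x \<oplus>\<^bsub>M\<^esub> y) =
      biduality R E M x \<oplus>\<^bsub>matlis_dual R E (matlis_dual R E M)\<^esub> biduality R E M y"
      using xy by (simp add: biduality_def cong: restrict_cong)
  next
    fix r x assume rx: "r \<in> carrier R" "x \<in> carrier M"
    have "f (r \<odot>\<^bsub>M\<^esub> x) = r \<odot>\<^bsub>E\<^esub> f x" if "f \<in> module_hom R M E" for f
      by (rule module_hom_smult[OF that rx])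
    then show "biduality R E M (r \<odot>\<^bsub>M\<^esub> x) =
      r \<odot>\<^bsub>matlis_dual R E (matlis_dual R E M)\<^esub> biduality R E M x"
      using rx by (simp add: biduality_def cong: restrict_cong)
  qed
qed

text \<open>On an Artinian module some finite set \<open>F\<close> of functionals separates points.  Hence the element
  that represents \<open>\<psi>\<close> on \<open>F\<close> also represents \<open>\<psi>\<close> on \<open>F\<close> enlarged by any further functional.\<close>

theorem biduality_iso:
  fixes M :: "('a, 'm) module"
  assumes art: "artinian_module R M"
  shows "biduality R E M \<in> module_iso R M (matlis_dual R E (matlis_dual R E M))"
proof -
  have M: "module R M" using art by (simp add: artinian_module_def)
  interpret M: module R M by fact
  have b: "biduality R E M x f = f x" if "x \<in> carrier M" "f \<in> module_hom R M E" for x f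
    using that by (simp add: biduality_def)
  have sep: "x = y" if x: "x \<in> carrier M" and y: "y \<in> carrier M"
    and eq: "\<And>f. f \<in> module_hom R M E \<Longrightarrow> f x = f y" for x y
  proof (rule ccontr)
    assume "x \<noteq> y"
    then have "x \<ominus>\<^bsub>M\<^esub> y \<notin> {\<zero>\<^bsub>M\<^esub>}" using x y by (simp add: M.M.diff_eq_zero_iff)
    then obtain f where f: "f \<in> module_hom R M E" "f (x \<ominus>\<^bsub>M\<^esub> y) \<noteq> \<zero>\<^bsub>E\<^esub>"
      using cogenerator[OF M M.zero_submodule M.M.minus_closed[OF x y]] by blast
    then show False
      using module_hom_diff[OF M module_E f(1) x y] eq[OF f(1)] module_hom_closed[OF f(1) y]
      by (simp add: E.M.minus_eq E.M.r_neg)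
  qed
  have "inj_on (biduality R E M) (carrier M)"
  proof (rule inj_onI)
    fix x y assume xy: "x \<in> carrier M" "y \<in> carrier M" "biduality R E M x = biduality R E M y"
    show "x = y"
    proof (rule sep[OF xy(1,2)])
      show "f x = f y" if "f \<in> module_hom R M E" for f
        using b[OF xy(1) that] b[OF xy(2) that] fun_cong[OF xy(3), of f] by (simp only:)
    qed
  qed
  moreover have "\<psi> \<in> biduality R E M ` carrier M"
    if \<psi>: "\<psi> \<in> module_hom R (matlis_dual R E M) E" for \<psi>
  proof -
    obtain F where F: "F \<subseteq> module_hom R M E" "finite F"
      "common_kernel E M F = common_kernel E M (module_hom R M E)"
      using artinian_common_kernel_finite[OF art module_E subset_refl] by blast
    obtain x where x: "x \<in> carrier M" "\<And>f. f \<in> F \<Longrightarrow> f x = \<psi> f"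
      using finite_evaluation[OF M \<psi> F(2,1)] by blast
    have "biduality R E M x = \<psi>"
    proof (rule module_hom_eqI[OF _ \<psi>])
      show "biduality R E M x \<in> module_hom R (matlis_dual R E M) E"
        by (rule evaluation_hom[OF M x(1)])
      fix f assume "f \<in> carrier (matlis_dual R E M)"
      then have f: "f \<in> module_hom R M E" by simp
      have "finite (insert f F)" "insert f F \<subseteq> module_hom R M E" using f F(1,2) by simp_all
      then obtain y where y: "y \<in> carrier M" "\<And>g. g \<in> insert f F \<Longrightarrow> g y = \<psi> g"
        using finite_evaluation[OF M \<psi>] by meson
      have "x \<ominus>\<^bsub>M\<^esub> y \<in> common_kernel E M F"
      proof -
        have "g (x \<ominus>\<^bsub>M\<^esub> y) = \<zero>\<^bsub>E\<^esub>" if g: "g \<in> F" for g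
        proof -
          have gM: "g \<in> module_hom R M E" using g F(1) by blast
          show ?thesis
            using module_hom_diff[OF M module_E gM x(1) y(1)] x(2)[OF g] y(2)[of g] g
              module_hom_closed[OF gM y(1)] by (simp add: E.M.minus_eq E.M.r_neg)
        qed
        then show ?thesis using x(1) y(1) by (simp add: common_kernel_def)
      qed
      then have "x \<ominus>\<^bsub>M\<^esub> y \<in> common_kernel E M (module_hom R M E)" by (simp only: F(3))
      then have "f (x \<ominus>\<^bsub>M\<^esub> y) = \<zero>\<^bsub>E\<^esub>" using f by (simp add: common_kernel_def)
      then have "f x = f y"
        using module_hom_diff[OF M module_E f x(1) y(1)]
          E.M.diff_eq_zero_iff[OF module_hom_closed[OF f x(1)] module_hom_closed[OF f y(1)]] by simp
      then show "biduality R E M x f = \<psi> f" using b[OF x(1) f] y(2)[of f] by simp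
    qed
    then show ?thesis using x(1) by blast
  qed
  moreover have "biduality R E M x \<in> module_hom R (matlis_dual R E M) E" if "x \<in> carrier M" for x
    by (rule evaluation_hom[OF M that])
  then have "biduality R E M ` carrier M \<subseteq> module_hom R (matlis_dual R E M) E"
    by (rule image_subsetI)
  ultimately have "bij_betw (biduality R E M) (carrier M) (module_hom R (matlis_dual R E M) E)"
    unfolding bij_betw_def by (intro conjI equalityI subsetI) auto
  then show ?thesis
    using biduality_hom[OF M] by (simp add: module_iso_def)
qed


section \<open>Hulls, cores and the dual closure\<close>

text \<open>
  Under \<open>B \<cong> B\<^sup>\<or>\<^sup>\<or>\<close> the submodule \<open>(B\<^sup>\<or>/L)\<^sup>\<or>\<close> corresponds to the common kernel of \<open>L\<close>, and invariance
  under isomorphisms moves the interior from \<open>B\<^sup>\<or>\<^sup>\<or>\<close> to \<open>B\<close>.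
\<close>

lemma dual_closure_eq_annihilator:
  fixes B :: "('a, 'u) module" and i :: "'u set \<Rightarrow> ('a, 'u) module \<Rightarrow> 'u set"
  assumes i: "relative_interior R i" and art: "artinian_module R B"
    and L: "submodule L R (matlis_dual R E B)"
  shows "dual_closure R E i L (matlis_dual R E B) = annihilator R E B (i (common_kernel E B L) B)"
proof -
  have B: "module R B" using art by (simp add: artinian_module_def)
  interpret B: module R B by fact
  let ?D = "matlis_dual R E B"
  let ?DD = "matlis_dual R E ?D"
  have D: "module R ?D" by (rule module_dual[OF B])
  have DD: "module R ?DD" by (rule module_dual[OF D])
  have LD: "L \<subseteq> module_hom R B E" using module.submoduleE(1)[OF D L] by simp
  note bid = biduality_iso[OF art]
  note bid' = module_isoE[OF bid]
  have bapp: "biduality R E B x f = f x" if "x \<in> carrier B" "f \<in> module_hom R B E" for x f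
    using that by (simp add: biduality_def)
  have idB: "(\<lambda>x\<in>carrier B. x) \<in> module_iso R B B"
    by (auto simp: module_iso_def bij_betw_def inj_on_def intro!: module_homI)
  \<comment> \<open>The inverse of the biduality map lands in the universe type of \<open>i\<close>.\<close>
  obtain \<phi> where \<phi>: "\<phi> \<in> module_iso R ?DD B"
    and \<phi>bid: "\<And>x. x \<in> carrier B \<Longrightarrow> \<phi> (biduality R E B x) = x"
  proof (rule that[OF module_iso_transition(1)[OF B bid idB]])
    fix x assume "x \<in> carrier B"
    then show "(\<lambda>y\<in>carrier ?DD. (\<lambda>x\<in>carrier B. x) (inv_into (carrier B) (biduality R E B) y))
        (biduality R E B x) = x"
      using module_iso_transition(2)[OF B bid idB] by simp
  qed
  define A' where "A' = dual_quotient R E ?D L"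
  have A'_eq: "A' = annihilator R E ?D L"
    unfolding A'_def by (rule dual_quotient_eq_annihilator[OF D module_E L])
  have A': "submodule A' R ?DD"
    unfolding A'_eq using LD by (intro submodule_annihilator[OF D module_E]) simp
  have mem: "biduality R E B x \<in> A' \<longleftrightarrow> x \<in> common_kernel E B L" if x: "x \<in> carrier B" for x
  proof -
    have "biduality R E B x \<in> module_hom R ?D E" using module_hom_closed[OF bid'(1) x] by simp
    moreover have "biduality R E B x f = f x" if "f \<in> L" for f using bapp[OF x] LD that by blast
    ultimately show ?thesis using x by (simp add: A'_eq annihilator_def common_kernel_def)
  qed
  have A'_sub: "A' \<subseteq> biduality R E B ` carrier B"
    using module.submoduleE(1)[OF DD A'] by (simp only: bid'(3))
  have \<phi>A': "\<phi> ` A' = common_kernel E B L"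
  proof
    show "\<phi> ` A' \<subseteq> common_kernel E B L"
    proof
      fix y assume "y \<in> \<phi> ` A'"
      then obtain x where "x \<in> carrier B" "biduality R E B x \<in> A'" "y = \<phi> (biduality R E B x)"
        using A'_sub by blast
      then show "y \<in> common_kernel E B L" using mem \<phi>bid by simp
    qed
    show "common_kernel E B L \<subseteq> \<phi> ` A'"
    proof
      fix x assume x: "x \<in> common_kernel E B L"
      then have "x \<in> carrier B" by (simp add: common_kernel_def)
      then show "x \<in> \<phi> ` A'" using x mem \<phi>bid by (intro image_eqI[of _ _ "biduality R E B x"]) simp_all
    qed
  qed
  define I where "I = interior_ext R i A' ?DD"
  have \<phi>I: "\<phi> ` I = i (common_kernel E B L) B"
    unfolding I_def using interior_ext_image[OF i DD art \<phi> A'] \<phi>A' by simp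
  have ck: "submodule (common_kernel E B L) R B" by (rule submodule_common_kernel[OF B module_E LD])
  have iB: "submodule (i (common_kernel E B L) B) R B"
    using i art ck by (simp add: relative_interior_def)
  have iBc: "i (common_kernel E B L) B \<subseteq> carrier B" by (rule B.submoduleE(1)[OF iB])
  have Ic: "I \<subseteq> carrier ?DD" by (auto simp: I_def interior_ext_def)
  have I_eq: "I = biduality R E B ` i (common_kernel E B L) B"
  proof
    show "I \<subseteq> biduality R E B ` i (common_kernel E B L) B"
    proof
      fix \<psi> assume \<psi>: "\<psi> \<in> I"
      then obtain x where x: "x \<in> carrier B" "\<psi> = biduality R E B x"
        using Ic unfolding bid'(3)[symmetric] by blast
      then have "x \<in> \<phi> ` I" using \<psi> \<phi>bid[OF x(1)] by (intro image_eqI[of _ _ \<psi>]) simp_all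
      then show "\<psi> \<in> biduality R E B ` i (common_kernel E B L) B" using x(2) \<phi>I by simp
    qed
    show "biduality R E B ` i (common_kernel E B L) B \<subseteq> I"
    proof
      fix \<psi> assume "\<psi> \<in> biduality R E B ` i (common_kernel E B L) B"
      then obtain x where x: "x \<in> \<phi> ` I" "\<psi> = biduality R E B x" using \<phi>I by blast
      then obtain \<eta> where \<eta>: "\<eta> \<in> I" "x = \<phi> \<eta>" by blast
      then obtain y where "y \<in> carrier B" "\<eta> = biduality R E B y"
        using Ic unfolding bid'(3)[symmetric] by blast
      then show "\<psi> \<in> I" using \<eta> x(2) \<phi>bid by simp
    qed
  qed
  have Isub: "submodule I R ?DD"
    unfolding I_eq by (rule submodule_image[OF B DD bid'(1) iB])
  have "f \<in> dual_closure R E i L ?D \<longleftrightarrow> f \<in> annihilator R E B (i (common_kernel E B L) B)"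
    if f: "f \<in> module_hom R B E" for f
  proof -
    have bf: "biduality R E ?D f \<in> module_hom R ?DD E"
      using module_hom_closed[OF biduality_hom[OF D], of f] f by simp
    have "f \<in> dual_closure R E i L ?D \<longleftrightarrow> biduality R E ?D f \<in> annihilator R E ?DD I"
      using f by (simp add: dual_closure_def A'_def[symmetric] I_def[symmetric]
        dual_quotient_eq_annihilator[OF DD module_E Isub])
    also have "\<dots> \<longleftrightarrow> (\<forall>x\<in>i (common_kernel E B L) B. biduality R E ?D f (biduality R E B x) = \<zero>\<^bsub>E\<^esub>)"
      using bf by (simp add: annihilator_def I_eq)
    also have "\<dots> \<longleftrightarrow> (\<forall>x\<in>i (common_kernel E B L) B. f x = \<zero>\<^bsub>E\<^esub>)"
    proof (rule ball_cong[OF refl])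
      fix x assume "x \<in> i (common_kernel E B L) B"
      then have x: "x \<in> carrier B" using iBc by blast
      then have "biduality R E ?D f (biduality R E B x) = f x"
        using f bapp[OF x f] module_hom_closed[OF bid'(1) x] by (simp add: biduality_def[of R E ?D])
      then show "(biduality R E ?D f (biduality R E B x) = \<zero>\<^bsub>E\<^esub>) = (f x = \<zero>\<^bsub>E\<^esub>)" by simp
    qed
    finally show ?thesis using f by (simp add: annihilator_def)
  qed
  moreover have "dual_closure R E i L ?D \<subseteq> module_hom R B E" by (auto simp: dual_closure_def)
  moreover have "annihilator R E B (i (common_kernel E B L) B) \<subseteq> module_hom R B E"
    by (auto simp: annihilator_def)
  ultimately show ?thesis by blast
qed

end

lemma submodule_submodule_sum:
  assumes M: "module R M" and F: "\<And>S. S \<in> F \<Longrightarrow> submodule S R M"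
  shows "submodule (submodule_sum M F) R M"
proof -
  interpret M: module R M by fact
  have FM: "\<Union>F \<subseteq> carrier M" using M.submoduleE(1)[OF F] by blast
  have cl: "x \<in> carrier M" if "x \<in> generate (add_monoid M) (\<Union>F)" for x
    using M.add.generate_in_carrier[of "\<Union>F" x] FM that by simp
  have sub: "subgroup (generate (add_monoid M) (\<Union>F)) (add_monoid M)"
    by (rule M.add.generate_is_subgroup[OF FM])
  have sm: "r \<odot>\<^bsub>M\<^esub> x \<in> generate (add_monoid M) (\<Union>F)"
    if r: "r \<in> carrier R" and "x \<in> generate (add_monoid M) (\<Union>F)" for r x
    using that(2)
  proof (induction x rule: generate.induct)
    case one
    then show ?case using r generate.one[of "add_monoid M" "\<Union>F"] by simp
  next
    case (incl h)
    then obtain S where S: "S \<in> F" "h \<in> S" by blast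
    then have "r \<odot>\<^bsub>M\<^esub> h \<in> \<Union>F" using M.submoduleE(4)[OF F[OF S(1)] r S(2)] by blast
    then show ?case by (rule generate.incl)
  next
    case (inv h)
    then obtain S where S: "S \<in> F" "h \<in> S" by blast
    then have "h \<in> carrier M" using FM by blast
    then have "r \<odot>\<^bsub>M\<^esub> (\<ominus>\<^bsub>M\<^esub> h) = \<ominus>\<^bsub>M\<^esub> (r \<odot>\<^bsub>M\<^esub> h)" using r by (simp add: M.smult_r_minus)
    moreover have "r \<odot>\<^bsub>M\<^esub> h \<in> \<Union>F" using M.submoduleE(4)[OF F[OF S(1)] r S(2)] S(1) by blast
    ultimately show ?case
      using generate.inv[of "r \<odot>\<^bsub>M\<^esub> h" "\<Union>F" "add_monoid M"] by (simp add: a_inv_def)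
  next
    case (eng x y)
    then show ?case
      using generate.eng[of "r \<odot>\<^bsub>M\<^esub> x" "add_monoid M" "\<Union>F" "r \<odot>\<^bsub>M\<^esub> y"] r cl
      by (simp add: M.smult_r_distr)
  qed
  show ?thesis
    unfolding submodule_sum_def
    by (intro submodule.intro submodule_axioms.intro sub sm)
qed

lemma annihilator_submodule_sum:
  assumes M: "module R M" and E: "module R E" and ne: "F \<noteq> {}"
    and F: "\<And>S. S \<in> F \<Longrightarrow> submodule S R M"
  shows "annihilator R E M (submodule_sum M F) = (\<Inter>S\<in>F. annihilator R E M S)"
proof
  interpret M: module R M by fact
  interpret E: module R E by fact
  show "annihilator R E M (submodule_sum M F) \<subseteq> (\<Inter>S\<in>F. annihilator R E M S)"
    using generate.incl[of _ "\<Union>F" "add_monoid M"] by (auto simp: annihilator_def submodule_sum_def)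
  show "(\<Inter>S\<in>F. annihilator R E M S) \<subseteq> annihilator R E M (submodule_sum M F)"
  proof
    fix f assume f: "f \<in> (\<Inter>S\<in>F. annihilator R E M S)"
    then have fM: "f \<in> module_hom R M E" using ne by (auto simp: annihilator_def)
    have "\<Union>F \<subseteq> common_kernel E M {f}"
      using f M.submoduleE(1)[OF F] by (fastforce simp: annihilator_def common_kernel_def)
    moreover have "subgroup (common_kernel E M {f}) (add_monoid M)"
      using submodule_common_kernel[OF M E, of "{f}"] fM by (simp add: submodule_def)
    ultimately have "generate (add_monoid M) (\<Union>F) \<subseteq> common_kernel E M {f}"
      by (rule M.add.generate_subgroup_incl)
    then show "f \<in> annihilator R E M (submodule_sum M F)"
      using fM by (auto simp: annihilator_def submodule_sum_def common_kernel_def)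
  qed
qed

theorem theorem6p6:
  fixes R :: "('a, 'r) ring_scheme" and \<mm> :: "'a set"
    and E :: "('a, 'e) module"
    and i :: "'u set \<Rightarrow> ('a, 'u) module \<Rightarrow> 'u set"
    and B :: "('a, 'u) module" and A :: "'u set"
  assumes "complete_noetherian_local_ring R \<mm>"
    and "injective_hull R (residue_module R \<mm>) E"
    and "nakayama_interior R \<mm> i"
    and "artinian_module R B"
    and "submodule A R B"
  shows "dual_quotient R E B (interior_hull R i A B) =
    closure_core R (dual_closure R E i) (dual_quotient R E B A) (matlis_dual R E B)"
proof -
  obtain e where "residue_hull R \<mm> E e" using injective_hull_residue_hull[OF assms(1,2)] ..
  then interpret residue_hull R \<mm> E e .
  have i: "relative_interior R i" using assms(3) by (simp add: nakayama_interior_def)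
  have B: "module R B" using assms(4) by (simp add: artinian_module_def)
  interpret B: module R B by fact
  note D = module_dual[OF B]
  \<comment> \<open>The families whose sum is the hull and whose intersection is the core.\<close>
  define expansions where "expansions = {C. submodule C R B \<and> A \<subseteq> C \<and> i C B \<subseteq> A}"
  define reductions where "reductions = {L. submodule L R (matlis_dual R E B) \<and>
    L \<subseteq> annihilator R E B A \<and> annihilator R E B A \<subseteq> dual_closure R E i L (matlis_dual R E B)}"
  have int: "submodule (i C B) R B" "i C B \<subseteq> C" if "submodule C R B" for C
    using i assms(4) that by (simp_all add: relative_interior_def)
  have expC: "submodule C R B" if "C \<in> expansions" for C using that by (simp add: expansions_def)
  have "A \<in> expansions" using assms(5) int(2) by (simp add: expansions_def)
  then have ne: "expansions \<noteq> {}" by blast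
  have anti: "annihilator R E B C \<subseteq> annihilator R E B C' \<longleftrightarrow> C' \<subseteq> C"
    if C: "submodule C R B" "submodule C' R B" for C C'
  proof
    show "annihilator R E B C \<subseteq> annihilator R E B C'" if "C' \<subseteq> C"
      using that by (auto simp: annihilator_def)
    assume "annihilator R E B C \<subseteq> annihilator R E B C'"
    then have "common_kernel E B (annihilator R E B C') \<subseteq> common_kernel E B (annihilator R E B C)"
      by (auto simp: common_kernel_def)
    then show "C' \<subseteq> C" using C by (simp add: common_kernel_annihilator[OF B])
  qed
  have red_iff: "annihilator R E B C \<in> reductions \<longleftrightarrow> C \<in> expansions" if C: "submodule C R B" for C
  proof -
    have L: "submodule (annihilator R E B C) R (matlis_dual R E B)"
      by (rule submodule_annihilator[OF B module_E B.submoduleE(1)[OF C]])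
    then show ?thesis
      using C assms(5) int(1)[OF C] anti
      by (simp add: reductions_def expansions_def common_kernel_annihilator[OF B]
          dual_closure_eq_annihilator[OF i assms(4) L])
  qed
  have "reductions = annihilator R E B ` expansions"
  proof
    show "annihilator R E B ` expansions \<subseteq> reductions" using red_iff expC by blast
    show "reductions \<subseteq> annihilator R E B ` expansions"
    proof
      fix L assume L: "L \<in> reductions"
      then have Lsub: "submodule L R (matlis_dual R E B)" by (simp add: reductions_def)
      let ?C = "common_kernel E B L"
      have "submodule ?C R B"
        using module.submoduleE(1)[OF D Lsub] by (intro submodule_common_kernel[OF B module_E]) simp
      moreover have LC: "annihilator R E B ?C = L" by (rule annihilator_common_kernel[OF assms(4) Lsub])
      ultimately have "?C \<in> expansions" using red_iff L by metis
      then show "L \<in> annihilator R E B ` expansions" using LC by (metis imageI)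
    qed
  qed
  moreover have "dual_quotient R E B (interior_hull R i A B) = (\<Inter>C\<in>expansions. annihilator R E B C)"
    unfolding interior_hull_def expansions_def[symmetric]
    using dual_quotient_eq_annihilator[OF B module_E submodule_submodule_sum[OF B expC]]
      annihilator_submodule_sum[OF B module_E ne expC] by simp
  moreover have "closure_core R (dual_closure R E i) (dual_quotient R E B A) (matlis_dual R E B) =
      \<Inter>reductions"
    by (simp add: closure_core_def reductions_def dual_quotient_eq_annihilator[OF B module_E assms(5)])
  ultimately show ?thesis by simp
qed

end
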